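(* Let $d\ge1$ and let $P:\mathbb{R}^d\to\mathbb{R}$ be a measurable function, not identically zero on $\mathbb{R}^d\setminus\{0\}$, such that $P\in L^1_{\rm loc}(\mathbb{R}^d)$, such that $P(-x)=(-1)^{\mathfrak{r}}P(x)$ for all $x\in\mathbb{R}^d$ with some $\mathfrak{r}\in\{0,1\}$, and such that the sub-level set $A_\lambda=\{x\in\mathbb{R}^d: |P(x)|\le\lambda\}$ has finite Lebesgue measure for some $\lambda>0$. Then there is a positive constant $C(P;d;1)$ such that $$\|f\|_1\le C(P;d;1)\,\|Pf\|_1$$ for all $f\in L^1(\mathbb{R}^d)$ with $\widehat f=\pm i^{\mathfrak{r}}f$ and $Pf\in L^1(\mathbb{R}^d)$. In particular, $P$ is admissible with respect to the exponent $q=\infty$. If, in addition, $P$ is homogeneous of degree $\gamma\ge 0$, i.e. $P(\delta x)=\delta^\gamma P(x)$ for all $\delta>0$ and $x\in\mathbb{R}^d$, then the constant $C(P;d;1)$ (understood as the best constant in the inequality above) can be bounded as follows: (i) If $\gamma=0$, then $$C(P;d;1)\le\big(\operatorname{ess\,inf}|P|\big)^{-1}<\infty.$$ (ii) If $\gamma>0$, then $$C(P;d;1)\le\left(1+\frac{\gamma}{d}\right)\left[\left(1+\frac{d}{\gamma}\right)|A_1|\right]^{\gamma/d}.$$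
   Context: The Fourier transform of $f\in L^1(\mathbb{R}^d)$ is $\widehat f(\xi)=\int_{\mathbb{R}^d}e^{-2\pi i x\cdot\xi}f(x)\,dx$. $|E|$ denotes the Lebesgue measure of $E\subset\mathbb{R}^d$, $B_r$ the open ball of radius $r$ centered at the origin, and $1/q+1/q'=1$. Admissibility: let $P:\mathbb{R}^d\to\mathbb{R}$ be locally integrable with $P(-x)=(-1)^{\mathfrak{r}}P(x)$ for all $x$, $\mathfrak{r}\in\{0,1\}$. $P$ is admissible with respect to an exponent $q$, $1\le q\le\infty$, if there is a positive constant $C(P;d;q)$ such that: (a) for all $f\in L^1(\mathbb{R}^d)$ with $\widehat f=\pm i^{\mathfrak{r}}f$ and $Pf\in L^1(\mathbb{R}^d)$ one has $\|f\|_q\le C(P;d;q)\,\|Pf\|_1$; and (b) if $q>1$ then $P\in L^{q'}_{\rm loc}(\mathbb{R}^d)$, while if $q=1$ then $\lim_{r\to0^+}\|P\|_{L^\infty(B_r)}=0$. *)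

theory Defs
  imports "HOL-Probability.Probability"
begin

definition fourier :: "('a::euclidean_space \<Rightarrow> complex) \<Rightarrow> 'a \<Rightarrow> complex" where
  "fourier f \<xi> = (LINT x|lebesgue. exp (- 2 * complex_of_real pi * \<i> * complex_of_real (x \<bullet> \<xi>)) * f x)"

text \<open>The extended-real valued L^q norm for \<open>1 \<le> q \<le> \<infinity>\<close>; it is \<open>\<infinity>\<close> for measurable functions
  outside L^q.\<close>

definition Lq_norm :: "'a measure \<Rightarrow> ennreal \<Rightarrow> ('a \<Rightarrow> 'b::real_normed_vector) \<Rightarrow> ennreal" where
  "Lq_norm M q f =
    (if q = \<infinity> then esssup M (\<lambda>x. ennreal (norm (f x)))
     else let I = (\<integral>\<^sup>+x. ennreal (norm (f x) powr enn2real q) \<partial>M)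
          in if I = \<infinity> then \<infinity> else ennreal (enn2real I powr (1 / enn2real q)))"

lemma Lq_norm_1: "Lq_norm M 1 f = (\<integral>\<^sup>+x. ennreal (norm (f x)) \<partial>M)"
  by (simp add: Lq_norm_def Let_def less_top)

definition locally_Lq :: "ennreal \<Rightarrow> ('a::euclidean_space \<Rightarrow> real) \<Rightarrow> bool" where
  "locally_Lq q P \<longleftrightarrow> P \<in> borel_measurable lebesgue \<and>
     (\<forall>K. compact K \<longrightarrow> Lq_norm (lebesgue_on K) q P < \<infinity>)"

definition ess_inf :: "'a measure \<Rightarrow> ('a \<Rightarrow> ennreal) \<Rightarrow> ennreal" where
  "ess_inf M f = Sup {z. AE x in M. z \<le> f x}"

definition has_parity :: "nat \<Rightarrow> ('a::euclidean_space \<Rightarrow> real) \<Rightarrow> bool" where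
  "has_parity r P \<longleftrightarrow> r \<in> {0, 1} \<and> (\<forall>x. P (- x) = (- 1) ^ r * P x)"

text \<open>Elements of L^1 are identified almost everywhere, so the eigenfunction equation is too.
  Both signs are allowed, and every constant below has to serve both.\<close>

definition test_functions :: "nat \<Rightarrow> ('a::euclidean_space \<Rightarrow> real) \<Rightarrow> ('a \<Rightarrow> complex) set" where
  "test_functions r P = {f. integrable lebesgue f \<and>
     (\<exists>s\<in>{1, - 1}. AE x in lebesgue. fourier f x = s * \<i> ^ r * f x) \<and>
     integrable lebesgue (\<lambda>x. complex_of_real (P x) * f x)}"

definition bounds_with :: "nat \<Rightarrow> ('a::euclidean_space \<Rightarrow> real) \<Rightarrow> ennreal \<Rightarrow> real \<Rightarrow> bool" where
  "bounds_with r P q C \<longleftrightarrow> (\<forall>f\<in>test_functions r P.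
     Lq_norm lebesgue q f \<le> ennreal C * Lq_norm lebesgue 1 (\<lambda>x. complex_of_real (P x) * f x))"

definition best_constant :: "nat \<Rightarrow> ('a::euclidean_space \<Rightarrow> real) \<Rightarrow> ennreal \<Rightarrow> ennreal" where
  "best_constant r P q = Inf {ennreal C | C. 0 < C \<and> bounds_with r P q C}"

text \<open>In \<open>ennreal\<close> one has \<open>1 / \<infinity> = 0\<close> and \<open>1 / 0 = \<infinity>\<close>, so \<open>1 / q + 1 / q' = 1\<close> determines the conjugate
  exponent also at the endpoints.\<close>

definition admissible :: "nat \<Rightarrow> ('a::euclidean_space \<Rightarrow> real) \<Rightarrow> ennreal \<Rightarrow> bool" where
  "admissible r P q \<longleftrightarrow> 1 \<le> q \<and> locally_Lq 1 P \<and> has_parity r P \<and>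
     (\<exists>C>0. bounds_with r P q C) \<and>
     (if q > 1 then \<exists>q'. 1 / q + 1 / q' = 1 \<and> locally_Lq q' P
      else ((\<lambda>\<rho>. Lq_norm (lebesgue_on (ball 0 \<rho>)) \<infinity> P) \<longlongrightarrow> 0) (at_right 0))"

definition homogeneous :: "real \<Rightarrow> ('a::euclidean_space \<Rightarrow> real) \<Rightarrow> bool" where
  "homogeneous \<gamma> P \<longleftrightarrow> (\<forall>\<delta>>0. \<forall>x. P (\<delta> *\<^sub>R x) = \<delta> powr \<gamma> * P x)"

definition sublevel :: "('a::euclidean_space \<Rightarrow> real) \<Rightarrow> real \<Rightarrow> 'a set" where
  "sublevel P t = {x. \<bar>P x\<bar> \<le> t}"

end

theory Submission
  imports Defs "HOL-Complex_Analysis.Great_Picard"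
begin

text \<open>
An eigenfunction \<open>f\<close> of the Fourier transform with unimodular eigenvalue satisfies
\<open>|f| \<le> \<parallel>f\<parallel>\<^sub>1\<close> almost everywhere, because the transform is bounded by \<open>\<parallel>f\<parallel>\<^sub>1\<close>. Hence the part of
\<open>f\<close> on a set \<open>A\<close> has mass at most \<open>|A| \<parallel>f\<parallel>\<^sub>1\<close>, whereas off the sub-level set \<open>A = A\<^sub>t\<close> one
has \<open>|f| \<le> |P f| / t\<close>. If \<open>|A\<^sub>t| < 1\<close>, the mass on \<open>A\<^sub>t\<close> can be absorbed, and
\<open>\<parallel>f\<parallel>\<^sub>1 \<le> \<parallel>P f\<parallel>\<^sub>1 / (t (1 - |A\<^sub>t|))\<close> (lemma \<open>bounds_with_small_sublevel\<close>). For homogeneous \<open>P\<close>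
of degree \<open>\<gamma> > 0\<close> scaling gives \<open>|A\<^sub>t| = t powr (d / \<gamma>) |A\<^sub>1|\<close>, and optimising \<open>t\<close> yields the
stated constant; for \<open>\<gamma> = 0\<close> the sub-level sets are cones, so one of finite measure is null.

For general \<open>P\<close> all sub-level sets may be large (\<open>P\<close> may vanish on a big ball), and absorption has
to be replaced by an uncertainty principle in the style of Amrein and Berthier: for \<open>|A| < \<infinity>\<close> the
norm \<open>\<parallel>f\<parallel>\<^sub>1\<close> of an eigenfunction is controlled by its mass off \<open>A\<close> (lemma
\<open>eigenfunction_annihilating\<close>). This is proved by contradiction. If normalised eigenfunctions \<open>f\<^sub>n\<close>
concentrate on \<open>A\<close>, then the transforms of their restrictions to \<open>A\<close> are uniformly bounded and
equicontinuous, so a subsequence converges pointwise; since \<open>f\<^sub>n\<close> is a multiple of its own transform,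
\<open>f\<^sub>n\<close> converges almost everywhere, and, being bounded by 1 and concentrated on \<open>A\<close>, also in
\<open>L\<^sup>1\<close>. The limit is an eigenfunction of norm 1 that vanishes off \<open>A\<close>.

Such a limit cannot exist (lemma \<open>eigenfunction_finite_support\<close>). Let \<open>f\<close> be an eigenfunction
with support \<open>F\<close> of finite measure. Translates of \<open>f\<close> by small multiples of one vector are supported
in a set \<open>U\<close> with \<open>|U| \<le> |F| + 1\<close>, and their transforms are characters times \<open>f\<close>, hence
supported in \<open>F\<close>. They span a space of any prescribed dimension \<open>N\<close>. For an orthonormal basis
\<open>u\<^sub>m\<close> of that space, Bessel's inequality against the characters cut off to \<open>U\<close> bounds the sum of
the squared transforms of the \<open>u\<^sub>m\<close> by \<open>|U|\<close> at every frequency; integrating over \<open>F\<close> gives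
\<open>N \<le> |U| |F|\<close>, which is false for large \<open>N\<close>. The isometry property needed on this space follows
from the eigenfunction equation and Fubini's theorem once \<open>f\<close> is even or odd, and the even and
odd parts of an eigenfunction are eigenfunctions again.
\<close>

section \<open>Elementary properties of the Fourier transform\<close>

lemma fourier_eq_cis: "fourier f \<xi> = (LINT x|lebesgue. cis (- (2 * pi * (x \<bullet> \<xi>))) * f x)"
  unfolding fourier_def cis_conv_exp by (simp add: algebra_simps)

lemma cis_inner_measurable_lborel [measurable]:
  "(\<lambda>x. cis (a * (x \<bullet> \<xi>))) \<in> borel_measurable (borel :: 'a::euclidean_space measure)"
  by (intro borel_measurable_continuous_onI continuous_intros)

lemma cis_inner_measurable [measurable]:
  "(\<lambda>x::'a::euclidean_space. cis (- (2 * pi * (x \<bullet> \<xi>)))) \<in> borel_measurable lebesgue"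
  using cis_inner_measurable_lborel[of "- (2 * pi)" \<xi>] by (auto intro!: measurable_completion)

lemma integrable_character_mult:
  assumes "integrable lebesgue f"
  shows "integrable lebesgue (\<lambda>x. cis (- (2 * pi * (x \<bullet> \<xi>))) * f x)"
  by (rule Bochner_Integration.integrable_bound[OF assms])
     (use assms in \<open>auto simp: norm_mult intro!: borel_measurable_times\<close>)

lemma norm_fourier_le: "norm (fourier f \<xi>) \<le> (LINT x|lebesgue. norm (f x))"
  unfolding fourier_eq_cis using integral_norm_bound[of lebesgue "\<lambda>x. cis (- (2 * pi * (x \<bullet> \<xi>))) * f x"]
  by (simp add: norm_mult)

lemma fourier_diff:
  assumes "integrable lebesgue f" "integrable lebesgue g"
  shows "fourier (\<lambda>x. f x - g x) \<xi> = fourier f \<xi> - fourier g \<xi>"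
  unfolding fourier_eq_cis
  using integrable_character_mult[OF assms(1)] integrable_character_mult[OF assms(2)]
  by (simp add: right_diff_distrib)

lemma fourier_cmult: "fourier (\<lambda>x. a * f x) \<xi> = a * fourier f \<xi>"
proof -
  have "cis (- (2 * pi * (x \<bullet> \<xi>))) * (a * f x) = a * (cis (- (2 * pi * (x \<bullet> \<xi>))) * f x)" for x
    by (simp only: mult_ac)
  then show ?thesis unfolding fourier_eq_cis by (simp only: integral_mult_right_zero)
qed

lemma fourier_cong_AE:
  assumes "integrable lebesgue f" "integrable lebesgue g" "AE x in lebesgue. f x = g x"
  shows "fourier f \<xi> = fourier g \<xi>"
  unfolding fourier_eq_cis
  by (rule integral_cong_AE)
     (use assms in \<open>auto intro!: borel_measurable_times\<close>)

text \<open>Continuity is what makes an eigenfunction equal almost everywhere to a continuous function with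
open support; it comes from dominated convergence, as characters have modulus 1.\<close>

lemma continuous_fourier:
  assumes "integrable lebesgue f"
  shows "continuous_on UNIV (fourier f)"
proof -
  have "(\<lambda>n. fourier f (y n)) \<longlonglongrightarrow> fourier f \<xi>" if "y \<longlonglongrightarrow> \<xi>" for y \<xi>
    unfolding fourier_eq_cis
  proof (rule integral_dominated_convergence[where w = "\<lambda>x. norm (f x)"])
    show "AE x in lebesgue. (\<lambda>n. cis (- (2 * pi * (x \<bullet> y n))) * f x) \<longlonglongrightarrow> cis (- (2 * pi * (x \<bullet> \<xi>))) * f x"
      by (intro AE_I2 tendsto_intros that)
  qed (use assms in \<open>auto simp: norm_mult intro!: borel_measurable_times\<close>)
  then show ?thesis
    by (auto simp: continuous_on_sequentially o_def)
qed

lemma fourier_lborel: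
  assumes "f \<in> borel_measurable borel"
  shows "fourier f \<xi> = (LINT x|lborel. cis (- (2 * pi * (x \<bullet> \<xi>))) * f x)"
  unfolding fourier_eq_cis
  using cis_inner_measurable_lborel[of "- (2 * pi)" \<xi>] assms
  by (intro integral_completion) auto

lemma lborel_integral_translate:
  fixes f :: "'a::euclidean_space \<Rightarrow> complex"
  assumes [measurable]: "f \<in> borel_measurable borel"
  shows "(LINT x|lborel. f (v + x)) = (LINT x|lborel. f x)"
  by (subst (2) lborel_distr_plus[of v, symmetric]) (simp add: integral_distr)

lemma lborel_integrable_translate:
  fixes f :: "'a::euclidean_space \<Rightarrow> complex"
  assumes "integrable lborel f"
  shows "integrable lborel (\<lambda>x. f (x - v))"
proof -
  have [measurable]: "f \<in> borel_measurable borel" using assms by auto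
  have "integrable (distr lborel borel ((+) (- v))) f"
    using assms by (simp add: lborel_distr_plus)
  then show ?thesis
    by (subst (asm) integrable_distr_eq) auto
qed

lemma distr_uminus_lborel:
  "distr lborel borel uminus = (lborel :: 'a::euclidean_space measure)"
  using lborel_affine[of "-1" "0::'a"] by (simp add: density_1)

lemma lborel_integrable_reflect:
  fixes f :: "'a::euclidean_space \<Rightarrow> complex"
  assumes "integrable lborel f"
  shows "integrable lborel (\<lambda>x. f (- x))"
proof -
  have [measurable]: "f \<in> borel_measurable borel" using assms by auto
  have "integrable (distr lborel borel uminus) f"
    using assms by (simp add: distr_uminus_lborel)
  then show ?thesis
    by (subst (asm) integrable_distr_eq) auto
qed

lemma fourier_translate:
  assumes [measurable]: "f \<in> borel_measurable borel"
  shows "fourier (\<lambda>x. f (x - v)) \<xi> = cis (- (2 * pi * (v \<bullet> \<xi>))) * fourier f \<xi>"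
proof -
  note [measurable] = cis_inner_measurable_lborel[of "- (2 * pi)", simplified]
  have "fourier (\<lambda>x. f (x - v)) \<xi>
      = (LINT x|lborel. cis (- (2 * pi * ((v + x) \<bullet> \<xi>))) * f ((v + x) - v))"
    by (subst fourier_lborel, measurable, rule lborel_integral_translate[symmetric], measurable)
  also have "\<dots> = (LINT x|lborel. cis (- (2 * pi * (v \<bullet> \<xi>))) * (cis (- (2 * pi * (x \<bullet> \<xi>))) * f x))"
    by (intro Bochner_Integration.integral_cong) (auto simp: cis_mult inner_add_left algebra_simps)
  finally show ?thesis
    by (simp add: fourier_lborel)
qed

lemma fourier_reflect:
  assumes [measurable]: "f \<in> borel_measurable borel"
  shows "fourier (\<lambda>x. f (- x)) \<xi> = fourier f (- \<xi>)"
proof -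
  note [measurable] = cis_inner_measurable_lborel[of "- (2 * pi)", simplified]
  have "fourier f (- \<xi>) = (LINT x|distr lborel borel uminus. cis (- (2 * pi * (x \<bullet> (- \<xi>)))) * f x)"
    by (simp add: fourier_lborel distr_uminus_lborel)
  also have "\<dots> = (LINT x|lborel. cis (- (2 * pi * ((- x) \<bullet> (- \<xi>)))) * f (- x))"
    by (subst integral_distr) auto
  finally show ?thesis
    by (simp add: fourier_lborel)
qed

text \<open>Fubini's theorem for the kernel \<open>cis (- 2 \<pi> x \<bullet> y) f y cnj (g x)\<close>. The conjugate
turns the character into its inverse, hence the argument \<open>- y\<close> on the right.\<close>

lemma fourier_multiplication_formula:
  fixes f g :: "'a::euclidean_space \<Rightarrow> complex"
  assumes f: "integrable lborel f" and g: "integrable lborel g"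
  shows "(LINT x|lborel. fourier f x * cnj (g x)) = (LINT y|lborel. f y * cnj (fourier g (- y)))"
proof -
  have [measurable]: "f \<in> borel_measurable borel" "g \<in> borel_measurable borel"
    using f g by auto
  have [measurable]: "(\<lambda>x. cnj (g x)) \<in> borel_measurable borel"
    using borel_measurable_integrable[of lborel "\<lambda>x. cnj (g x)"] g by simp
  define K where "K x y = cis (- (2 * pi * (y \<bullet> x))) * f y * cnj (g x)" for x y :: 'a
  have [measurable]: "(\<lambda>z. cis (- (2 * pi * (snd z \<bullet> fst z)))) \<in> borel_measurable (borel \<Otimes>\<^sub>M (borel :: 'a measure))"
    unfolding borel_prod by (intro borel_measurable_continuous_onI continuous_intros)
  have "(\<lambda>z. K (fst z) (snd z)) \<in> borel_measurable (borel \<Otimes>\<^sub>M (borel :: 'a measure))"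
    unfolding K_def by measurable
  then have Km: "(\<lambda>z. K (fst z) (snd z)) \<in> borel_measurable (lborel \<Otimes>\<^sub>M (lborel :: 'a measure))"
    by (subst measurable_cong_sets[OF sets_pair_measure_cong[OF sets_lborel sets_lborel] refl])
  have int: "integrable (lborel \<Otimes>\<^sub>M lborel) (\<lambda>(x, y). K x y)"
  proof (rule lborel_pair.Fubini_integrable)
    show "integrable lborel (\<lambda>x. LINT y|lborel. norm (case (x, y) of (x, y) \<Rightarrow> K x y))"
      using g by (simp add: K_def norm_mult mult.commute[of _ "norm (g _)"])
    show "AE x in lborel. integrable lborel (\<lambda>y. case (x, y) of (x, y) \<Rightarrow> K x y)"
    proof (rule AE_I2)
      fix x
      show "integrable lborel (\<lambda>y. case (x, y) of (x, y) \<Rightarrow> K x y)"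
        unfolding K_def case_prod_conv
        apply (rule integrable_mult_left)
        apply (rule Bochner_Integration.integrable_bound[OF f])
        using cis_inner_measurable_lborel[of "- (2 * pi)" x] 
        apply (auto simp: norm_mult intro!: borel_measurable_times)
        done
    qed
  qed (use Km in \<open>simp add: case_prod_beta\<close>)
  have "(LINT y|lborel. LINT x|lborel. K x y) = (LINT x|lborel. LINT y|lborel. K x y)"
    using lborel_pair.Fubini_integral[OF int] .
  moreover have "(LINT y|lborel. K x y) = fourier f x * cnj (g x)" for x
    unfolding K_def by (simp add: fourier_lborel)
  moreover have "(LINT x|lborel. K x y) = f y * cnj (fourier g (- y))" for y
  proof -
    have "(LINT x|lborel. K x y) = (LINT x|lborel. f y * cnj (cis (- (2 * pi * (x \<bullet> (- y)))) * g x))"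
      unfolding K_def by (intro Bochner_Integration.integral_cong) (auto simp: cis_cnj inner_commute)
    then show ?thesis
      by (simp add: fourier_lborel del: complex_cnj_mult)
  qed
  ultimately show ?thesis by simp
qed

section \<open>Gram-Schmidt and Bessel\<close>

text \<open>Each step orthogonalises the monomial of degree \<open>N\<close> against the earlier polynomials; the
result is monic, hence nonzero, and can be normalised. Polynomials stand for linear combinations
of translates: the coefficient of degree \<open>j\<close> belongs to the \<open>j\<close>-th translate.\<close>

lemma polynomial_gram_schmidt:
  fixes B :: "complex poly \<Rightarrow> complex poly \<Rightarrow> complex"
  assumes add: "\<And>p q s. B (p + q) s = B p s + B q s"
    and scale: "\<And>a p q. B (smult a p) q = a * B p q"
    and herm: "\<And>p q. B q p = cnj (B p q)"
    and pos: "\<And>p. p \<noteq> 0 \<Longrightarrow> \<exists>r>0. B p p = complex_of_real r"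
  shows "\<exists>p. (\<forall>m<N. degree (p m) < N) \<and> (\<forall>m<N. \<forall>n<N. B (p m) (p n) = (if m = n then 1 else 0))"
proof (induction N)
  case 0
  show ?case by auto
next
  case (Suc N)
  then obtain p where deg: "\<And>m. m < N \<Longrightarrow> degree (p m) < N"
    and orth: "\<And>m n. m < N \<Longrightarrow> n < N \<Longrightarrow> B (p m) (p n) = (if m = n then 1 else 0)"
    by blast
  have B0: "B 0 s = 0" for s using scale[of 0 0 s] by simp
  have Bsum: "B (\<Sum>m\<in>S. smult (a m) (p m)) s = (\<Sum>m\<in>S. a m * B (p m) s)" if "finite S" for S a s
    using that by (induction S) (auto simp: B0 add scale)
  define S where "S = (\<Sum>m<N. smult (- B (monom 1 N) (p m)) (p m))"
  define q where "q = monom 1 N + S"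
  have q_orth: "B q (p n) = 0" if "n < N" for n
    using that by (simp add: q_def S_def add Bsum orth if_distrib cong: if_cong del: smult_minus_left)
  have "coeff S N = 0"
    unfolding S_def coeff_sum by (intro sum.neutral) (auto simp: coeff_eq_0 deg)
  then have "coeff q N = 1" by (simp add: q_def)
  then have "q \<noteq> 0" by auto
  then obtain r where r: "r > 0" "B q q = complex_of_real r" using pos by blast
  have degS: "degree S \<le> N"
    unfolding S_def by (intro degree_sum_le) (auto intro: order_trans[OF degree_smult_le] less_imp_le deg)
  then have degq: "degree q \<le> N"
    unfolding q_def by (intro degree_add_le) (auto simp: degree_monom_le)
  define p' where "p' = p(N := smult (1 / complex_of_real (sqrt r)) q)"
  have scale_r: "B p (smult a q) = cnj a * B p q" for a p q
  proof -
    have "B p (smult a q) = cnj (a * B q p)"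
      unfolding scale[symmetric] by (rule herm)
    then show ?thesis by (simp add: herm[of p q])
  qed
  have "B (p' m) (p' n) = (if m = n then 1 else 0)" if "m < Suc N" "n < Suc N" for m n
  proof -
    have "complex_of_real (sqrt r) * complex_of_real (sqrt r) = complex_of_real r"
      using r by (metis of_real_mult real_sqrt_mult_self abs_of_pos)
    moreover have "B (p n) q = 0" if "n < N" for n
      using herm[of q "p n"] q_orth[OF that] by simp
    ultimately show ?thesis
      using that r q_orth orth
      by (auto simp: p'_def scale scale_r less_Suc_eq)
  qed
  moreover have "degree (p' m) < Suc N" if "m < Suc N" for m
    using that deg[of m] degq degree_smult_le[of "1 / complex_of_real (sqrt r)" q]
    by (auto simp: p'_def less_Suc_eq)
  ultimately show ?case by blast
qed

text \<open>The square norm of \<open>\<phi>\<close> minus its orthogonal projection is nonnegative.\<close>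

lemma bessel_inequality:
  fixes u :: "nat \<Rightarrow> 'a \<Rightarrow> complex"
  assumes uu: "\<And>m n. m < N \<Longrightarrow> n < N \<Longrightarrow> integrable M (\<lambda>x. u m x * cnj (u n x))"
    and orth: "\<And>m n. m < N \<Longrightarrow> n < N \<Longrightarrow> (LINT x|M. u m x * cnj (u n x)) = (if m = n then 1 else 0)"
    and pp: "integrable M (\<lambda>x. \<phi> x * cnj (\<phi> x))"
    and up: "\<And>m. m < N \<Longrightarrow> integrable M (\<lambda>x. u m x * cnj (\<phi> x))"
  shows "(\<Sum>m<N. (norm (LINT x|M. u m x * cnj (\<phi> x)))\<^sup>2) \<le> (LINT x|M. (norm (\<phi> x))\<^sup>2)"
proof -
  define b where "b m = (LINT x|M. u m x * cnj (\<phi> x))" for m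
  define S where "S x = (\<Sum>m<N. cnj (b m) * u m x)" for x
  have pu: "integrable M (\<lambda>x. \<phi> x * cnj (u m x))" if "m < N" for m
    using up[OF that] integrable_cnj[of M "\<lambda>x. u m x * cnj (\<phi> x)"] by (simp add: mult.commute)
  have ipu: "(LINT x|M. \<phi> x * cnj (u m x)) = cnj (b m)" if "m < N" for m
  proof -
    have "(LINT x|M. \<phi> x * cnj (u m x)) = (LINT x|M. cnj (u m x * cnj (\<phi> x)))"
      by (simp add: mult.commute)
    then show ?thesis unfolding b_def by (simp only: Bochner_Integration.integral_cnj)
  qed
  have e: "(\<phi> x - S x) * cnj (\<phi> x - S x) = \<phi> x * cnj (\<phi> x)
     - (\<Sum>m<N. cnj (b m) * (u m x * cnj (\<phi> x))) - (\<Sum>m<N. b m * (\<phi> x * cnj (u m x)))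
     + (\<Sum>m<N. \<Sum>n<N. cnj (b m) * b n * (u m x * cnj (u n x)))" for x
    by (simp add: S_def algebra_simps sum_distrib_left sum_distrib_right cnj_sum)
  have "(LINT x|M. (\<phi> x - S x) * cnj (\<phi> x - S x)) = (LINT x|M. \<phi> x * cnj (\<phi> x))
     - (\<Sum>m<N. cnj (b m) * b m) - (\<Sum>m<N. b m * cnj (b m))
     + (\<Sum>m<N. \<Sum>n<N. cnj (b m) * b n * (if m = n then 1 else 0))"
  proof -
    have 1: "integrable M (\<lambda>x. \<Sum>m<N. cnj (b m) * (u m x * cnj (\<phi> x)))"
      by (intro Bochner_Integration.integrable_sum integrable_mult_right up) auto
    have 2: "integrable M (\<lambda>x. \<Sum>m<N. b m * (\<phi> x * cnj (u m x)))"
      by (intro Bochner_Integration.integrable_sum integrable_mult_right pu) auto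
    have 3: "integrable M (\<lambda>x. \<Sum>n<N. cnj (b m) * b n * (u m x * cnj (u n x)))" if "m < N" for m
      using that by (intro Bochner_Integration.integrable_sum integrable_mult_right uu) auto
    have 4: "(LINT x|M. (\<Sum>m<N. cnj (b m) * (u m x * cnj (\<phi> x)))) = (\<Sum>m<N. cnj (b m) * b m)"
      using up by (subst Bochner_Integration.integral_sum) (auto simp: b_def)
    have 5: "(LINT x|M. (\<Sum>m<N. b m * (\<phi> x * cnj (u m x)))) = (\<Sum>m<N. b m * cnj (b m))"
      using pu by (subst Bochner_Integration.integral_sum) (auto simp: ipu)
    have 6: "(LINT x|M. (\<Sum>n<N. cnj (b m) * b n * (u m x * cnj (u n x))))
        = (\<Sum>n<N. cnj (b m) * b n * (if m = n then 1 else 0))" if "m < N" for m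
      using uu that orth by (subst Bochner_Integration.integral_sum) (auto intro!: sum.cong)
    have 7: "(LINT x|M. (\<Sum>m<N. \<Sum>n<N. cnj (b m) * b n * (u m x * cnj (u n x))))
        = (\<Sum>m<N. \<Sum>n<N. cnj (b m) * b n * (if m = n then 1 else 0))"
      using 3 6 by (subst Bochner_Integration.integral_sum) auto
    have 8: "integrable M (\<lambda>x. \<Sum>m<N. \<Sum>n<N. cnj (b m) * b n * (u m x * cnj (u n x)))"
      by (rule Bochner_Integration.integrable_sum, rule 3) simp
    show ?thesis
      unfolding e using pp 1 2 4 5 7 8
      by (simp only: Bochner_Integration.integral_add Bochner_Integration.integral_diff
          Bochner_Integration.integrable_diff)
  qed
  also have "\<dots> = (LINT x|M. \<phi> x * cnj (\<phi> x)) - (\<Sum>m<N. b m * cnj (b m))"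
    by (simp add: if_distrib sum.delta mult.commute cong: if_cong)
  finally have "(LINT x|M. complex_of_real ((norm (\<phi> x - S x))\<^sup>2))
      = (LINT x|M. complex_of_real ((norm (\<phi> x))\<^sup>2)) - (\<Sum>m<N. complex_of_real ((norm (b m))\<^sup>2))"
    by (simp only: complex_norm_square)
  then have "complex_of_real (LINT x|M. (norm (\<phi> x - S x))\<^sup>2)
      = complex_of_real ((LINT x|M. (norm (\<phi> x))\<^sup>2) - (\<Sum>m<N. (norm (b m))\<^sup>2))"
    by (simp only: integral_complex_of_real of_real_diff of_real_sum)
  then have "(LINT x|M. (norm (\<phi> x - S x))\<^sup>2) = (LINT x|M. (norm (\<phi> x))\<^sup>2) - (\<Sum>m<N. (norm (b m))\<^sup>2)"
    by (simp only: of_real_eq_iff)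
  moreover have "0 \<le> (LINT x|M. (norm (\<phi> x - S x))\<^sup>2)" by simp
  ultimately show ?thesis by (simp add: b_def)
qed

section \<open>Eigenfunctions supported on a set of finite measure vanish\<close>

text \<open>For open \<open>F\<close> the indicator of \<open>F \<inter> (F + v)\<close> tends pointwise to that of \<open>F\<close> as
\<open>v\<close> tends to 0, so by dominated convergence a small translation moves little mass out of \<open>F\<close>.
Hence any number \<open>N\<close> of translates fits into a set that is hardly larger than \<open>F\<close>, if the step
\<open>t\<close> is small enough.\<close>

lemma small_translations:
  fixes F :: "'a::euclidean_space set" and e :: 'a
  assumes "open F" and fin: "emeasure lborel F < \<infinity>"
  shows "\<exists>t>0. emeasure lborel (\<Union>j<N. {x. x - (real j * t) *\<^sub>R e \<in> F}) < \<infinity> \<and>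
    measure lborel (\<Union>j<N. {x. x - (real j * t) *\<^sub>R e \<in> F}) \<le> measure lborel F + 1"
proof -
  have Fb[measurable]: "F \<in> sets borel" using assms by auto
  define T where "T v = {x. x - v \<in> F}" for v
  have Tv: "T v = (+) (- v) -` F" for v by (auto simp: T_def)
  have T[measurable]: "T v \<in> sets borel" for v
    unfolding Tv by (intro borel_open open_vimage assms continuous_intros)
  have eT: "emeasure lborel (T v) = emeasure lborel F" for v
  proof -
    have "emeasure lborel F = emeasure (distr lborel borel ((+) (- v))) F"
      by (simp add: lborel_distr_plus)
    also have "\<dots> = emeasure lborel ((+) (- v) -` F \<inter> space lborel)"
      by (rule emeasure_distr) auto
    finally show ?thesis unfolding Tv by simp
  qed
  have Tf: "T v \<in> fmeasurable lborel" for v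
    using fin eT by (auto intro!: fmeasurableI)
  have Ff: "F \<in> fmeasurable lborel"
    using fin by (auto intro!: fmeasurableI)
  have mT: "measure lborel (T v) = measure lborel F" for v
    by (simp add: measure_def eT)
  have lim: "(\<lambda>n. measure lborel (T (v n) - F)) \<longlonglongrightarrow> 0" if v: "v \<longlonglongrightarrow> 0" for v :: "nat \<Rightarrow> 'a"
  proof -
    have "(\<lambda>n. LINT x|lborel. indicator (T (v n) \<inter> F) x :: real) \<longlonglongrightarrow> (LINT x|lborel. indicator F x)"
    proof (rule integral_dominated_convergence[where w = "indicator F"])
      show "AE x in lborel. (\<lambda>n. indicator (T (v n) \<inter> F) x :: real) \<longlonglongrightarrow> indicator F x"
      proof (rule AE_I2)
        fix x
        show "(\<lambda>n. indicator (T (v n) \<inter> F) x :: real) \<longlonglongrightarrow> indicator F x"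
        proof (cases "x \<in> F")
          case True
          have "(\<lambda>n. x - v n) \<longlonglongrightarrow> x - 0" by (intro tendsto_intros v)
          then have "\<forall>\<^sub>F n in sequentially. x - v n \<in> F"
            using True \<open>open F\<close> by (auto dest: topological_tendstoD)
          then have "\<forall>\<^sub>F n in sequentially. indicator (T (v n) \<inter> F) x = (indicator F x :: real)"
            by eventually_elim (simp add: T_def indicator_def)
          then show ?thesis by (rule tendsto_eventually)
        qed simp
      qed
    qed (use fin in \<open>auto intro!: integrable_real_indicator split: split_indicator\<close>)
    then have "(\<lambda>n. measure lborel (T (v n) \<inter> F)) \<longlonglongrightarrow> measure lborel F" by simp
    from tendsto_diff[OF tendsto_const[of "measure lborel F"] this]
    have "(\<lambda>n. measure lborel F - measure lborel (T (v n) \<inter> F)) \<longlonglongrightarrow> 0" by simp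
    moreover have "measure lborel F - measure lborel (T (v n) \<inter> F) = measure lborel (T (v n) - F)" for n
    proof -
      have "measure lborel (T (v n) - (T (v n) \<inter> F)) = measure lborel (T (v n)) - measure lborel (T (v n) \<inter> F)"
        using Tf[of "v n"] by (intro measure_Diff) (auto simp: fmeasurable_def)
      moreover have "T (v n) - (T (v n) \<inter> F) = T (v n) - F" by auto
      ultimately show ?thesis by (simp add: mT)
    qed
    ultimately show ?thesis by simp
  qed
  define s where "s n = 1 / real (Suc n)" for n
  have s: "s \<longlonglongrightarrow> 0" unfolding s_def using LIMSEQ_inverse_real_of_nat by (simp add: inverse_eq_divide)
  have "(\<lambda>n. \<Sum>j<N. measure lborel (T ((real j * s n) *\<^sub>R e) - F)) \<longlonglongrightarrow> (\<Sum>j<N. 0)"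
  proof (intro tendsto_sum lim)
    fix j
    have "(\<lambda>n. (real j * s n) *\<^sub>R e) \<longlonglongrightarrow> (real j * 0) *\<^sub>R e"
      by (intro tendsto_intros s)
    then show "(\<lambda>n. (real j * s n) *\<^sub>R e) \<longlonglongrightarrow> 0" by simp
  qed
  then have "\<forall>\<^sub>F n in sequentially. (\<Sum>j<N. measure lborel (T ((real j * s n) *\<^sub>R e) - F)) < 1"
    by (rule order_tendstoD) simp
  then obtain n where n: "(\<Sum>j<N. measure lborel (T ((real j * s n) *\<^sub>R e) - F)) < 1"
    by (auto simp: eventually_sequentially)
  define U where "U = (\<Union>j<N. T ((real j * s n) *\<^sub>R e))"
  have U: "U \<in> fmeasurable lborel"
    unfolding U_def using Tf by (intro fmeasurable.finite_UN) auto
  define D where "D = (\<Union>j<N. T ((real j * s n) *\<^sub>R e) - F)"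
  have D: "D \<in> fmeasurable lborel"
    unfolding D_def using Tf by (intro fmeasurable.finite_UN fmeasurable_Diff) auto
  have "measure lborel U \<le> measure lborel (F \<union> D)"
    using U D Ff by (intro measure_mono_fmeasurable fmeasurable.Un) (auto simp: U_def D_def)
  also have "\<dots> \<le> measure lborel F + measure lborel D"
    using D Ff by (intro measure_Un_le) auto
  also have "measure lborel D \<le> (\<Sum>j<N. measure lborel (T ((real j * s n) *\<^sub>R e) - F))"
    unfolding D_def using Tf by (intro measure_UNION_le) auto
  finally have "measure lborel U \<le> measure lborel F + 1" using n by simp
  moreover have "emeasure lborel U < \<infinity>" using U by (auto simp: fmeasurable_def)
  moreover have "s n > 0" by (simp add: s_def)
  ultimately show ?thesis unfolding U_def T_def by blast
qed

text \<open>The polynomial has finitely many roots, and the points where the character takes a given value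
lie on countably many parallel hyperplanes. This makes the translates of a nonzero function
linearly independent.\<close>

lemma negligible_trigonometric_zeros:
  fixes p :: "complex poly" and e :: "'a::euclidean_space"
  assumes "p \<noteq> 0" "t \<noteq> 0" "e \<noteq> 0"
  shows "{x::'a. poly p (cis (2 * pi * (t * (e \<bullet> x)))) = 0} \<in> null_sets lborel"
proof -
  have *: "{x::'a. cis (2 * pi * (t * (e \<bullet> x))) = w} \<in> null_sets lebesgue" for w
  proof (cases "\<exists>x::'a. cis (2 * pi * (t * (e \<bullet> x))) = w")
    case True
    then obtain x0 :: 'a where x0: "cis (2 * pi * (t * (e \<bullet> x0))) = w" by blast
    have "{x::'a. cis (2 * pi * (t * (e \<bullet> x))) = w} \<subseteq> (\<Union>n::int. {x. e \<bullet> x = e \<bullet> x0 + n / t})"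
    proof
      fix x :: 'a assume "x \<in> {x. cis (2 * pi * (t * (e \<bullet> x))) = w}"
      then have "cis (2 * pi * (t * (e \<bullet> x))) = cis (2 * pi * (t * (e \<bullet> x0)))" using x0 by simp
      then have "sin (2 * pi * (t * (e \<bullet> x))) = sin (2 * pi * (t * (e \<bullet> x0)))"
        "cos (2 * pi * (t * (e \<bullet> x))) = cos (2 * pi * (t * (e \<bullet> x0)))"
        by (auto simp: complex_eq_iff)
      then obtain n :: int where "2 * pi * (t * (e \<bullet> x)) = 2 * pi * (t * (e \<bullet> x0)) + 2 * pi * n"
        using sin_cos_eq_iff by blast
      then have "2 * pi * (t * (e \<bullet> x)) = 2 * pi * (t * (e \<bullet> x0) + n)" by (simp add: algebra_simps)
      then have "t * (e \<bullet> x) = t * (e \<bullet> x0) + n" by simp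
      then have "e \<bullet> x = e \<bullet> x0 + n / t" using \<open>t \<noteq> 0\<close> by (simp add: field_simps)
      then show "x \<in> (\<Union>n::int. {x. e \<bullet> x = e \<bullet> x0 + n / t})" by blast
    qed
    moreover have "negligible (\<Union>n::int. {x. e \<bullet> x = e \<bullet> x0 + n / t})"
      using \<open>e \<noteq> 0\<close> by (intro negligible_countable_Union) (auto intro: negligible_hyperplane)
    ultimately show ?thesis
      using negligible_subset negligible_iff_null_sets by blast
  next
    case False
    then show ?thesis by simp
  qed
  have "{x::'a. poly p (cis (2 * pi * (t * (e \<bullet> x)))) = 0}
      = (\<Union>w\<in>{w. poly p w = 0}. {x. cis (2 * pi * (t * (e \<bullet> x))) = w})" by auto
  also have "\<dots> \<in> null_sets lebesgue"
    using poly_roots_finite[OF \<open>p \<noteq> 0\<close>] * by (intro null_sets_UN') (auto intro: countable_finite)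
  finally have "{x::'a. poly p (cis (2 * pi * (t * (e \<bullet> x)))) = 0} \<in> null_sets lebesgue" .
  moreover have "{x::'a. poly p (cis (2 * pi * (t * (e \<bullet> x)))) = 0} \<in> sets borel"
    by (intro borel_closed closed_Collect_eq continuous_intros)
  ultimately show ?thesis
    by (simp add: null_sets_def)
qed

text \<open>A translate of \<open>f\<close> is, up to the factor \<open>c\<close>, the transform of \<open>f\<close> times a character.
The multiplication formula moves that transform to the other translate, and the parity of \<open>f\<close>
undoes the reflection which the conjugation causes.\<close>

lemma eigenfunction_translates_inner_product:
  fixes f :: "'a::euclidean_space \<Rightarrow> complex"
  assumes int: "integrable lborel f"
    and eig: "\<And>\<xi>. fourier f \<xi> = c * f \<xi>" and c: "norm c = 1"
    and parity: "\<And>x. f (- x) = \<epsilon> * f x"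
  shows "c * (LINT x|lborel. f (x - v) * cnj (f (x - w)))
    = cnj c * cnj \<epsilon> * (LINT x|lborel. cis (2 * pi * (v \<bullet> x)) * cnj (cis (2 * pi * (w \<bullet> x))) * (f x * cnj (f x)))"
proof -
  have [measurable]: "f \<in> borel_measurable borel" using int by auto
  have cm: "(\<lambda>x. cis (2 * pi * (v \<bullet> x))) \<in> borel_measurable borel"
    by (intro borel_measurable_continuous_onI continuous_intros)
  define g where "g x = cis (2 * pi * (v \<bullet> x)) * f x" for x
  have gm: "g \<in> borel_measurable borel" unfolding g_def using cm by (intro borel_measurable_times) auto
  have g: "integrable lborel g"
    by (rule Bochner_Integration.integrable_bound[OF int]) (use gm in \<open>auto simp: g_def norm_mult\<close>)
  have "fourier g x = fourier f (x - v)" for x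
  proof -
    have "cis (- (2 * pi * (y \<bullet> x))) * g y = cis (- (2 * pi * (y \<bullet> (x - v)))) * f y" for y
    proof -
      have "- (2 * pi * (y \<bullet> x)) + 2 * pi * (v \<bullet> y) = - (2 * pi * (y \<bullet> (x - v)))"
        by (simp add: inner_diff_right inner_commute[of v y] algebra_simps)
      then show ?thesis by (simp only: g_def mult.assoc[symmetric] cis_mult)
    qed
    then show ?thesis
      using gm by (simp only: fourier_lborel \<open>f \<in> borel_measurable borel\<close>)
  qed
  then have Fg: "fourier g x = c * f (x - v)" for x by (simp add: eig)
  have Fh: "fourier (\<lambda>x. f (x - w)) (- y) = cis (2 * pi * (w \<bullet> y)) * (c * (\<epsilon> * f y))" for y
    by (simp add: fourier_translate eig parity)
  have "c * (LINT x|lborel. f (x - v) * cnj (f (x - w))) = (LINT x|lborel. fourier g x * cnj (f (x - w)))"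
    by (simp add: Fg mult.assoc)
  also have "\<dots> = (LINT y|lborel. g y * cnj (fourier (\<lambda>x. f (x - w)) (- y)))"
    by (rule fourier_multiplication_formula[OF g lborel_integrable_translate[OF int]])
  also have "\<dots> = (LINT y|lborel. cnj c * cnj \<epsilon> * (cis (2 * pi * (v \<bullet> y)) * cnj (cis (2 * pi * (w \<bullet> y))) * (f y * cnj (f y))))"
  proof (intro Bochner_Integration.integral_cong refl)
    fix y
    show "g y * cnj (fourier (\<lambda>x. f (x - w)) (- y))
        = cnj c * cnj \<epsilon> * (cis (2 * pi * (v \<bullet> y)) * cnj (cis (2 * pi * (w \<bullet> y))) * (f y * cnj (f y)))"
      unfolding Fh g_def complex_cnj_mult by (simp only: mult_ac)
  qed
  finally show ?thesis by simp
qed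

text \<open>The dimension count: \<open>N\<close> orthonormal combinations of translates, all concentrated in \<open>U\<close> in
space and in \<open>F\<close> in frequency, force \<open>N \<le> |U| |F|\<close>. The scalar \<open>\<epsilon>\<close> is the parity.\<close>

lemma eigenfunction_finite_support_parity:
  fixes f :: "'a::euclidean_space \<Rightarrow> complex"
  assumes int: "integrable lborel f" and cont: "continuous_on UNIV f"
    and eig: "\<And>\<xi>. fourier f \<xi> = c * f \<xi>" and c: "norm c = 1"
    and parity: "\<And>x. f (- x) = \<epsilon> * f x" and eps: "norm \<epsilon> = 1"
    and fin: "emeasure lborel {x. f x \<noteq> 0} < \<infinity>"
  shows "f x = 0"
proof (rule ccontr)
  assume "f x \<noteq> 0"
  have [measurable]: "f \<in> borel_measurable borel" using int by auto
  define F where "F = {x. f x \<noteq> 0}"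
  have "open F"
    unfolding F_def using open_Collect_neq[OF cont continuous_on_const] .
  then have Fb[measurable]: "F \<in> sets borel" by auto
  have "F \<noteq> {}" using \<open>f x \<noteq> 0\<close> by (auto simp: F_def)
  have Fpos: "F \<notin> null_sets lborel"
    using \<open>open F\<close> \<open>F \<noteq> {}\<close> open_not_negligible[of F] null_sets_completionI[of F lborel]
    by (auto simp: negligible_iff_null_sets)
  define A where "A = (LINT x|lborel. norm (f x))"
  have bound: "norm (f x) \<le> A" for x
  proof -
    have "norm (f x) = norm (fourier f x)" by (simp add: eig norm_mult c)
    also have "\<dots> \<le> (LINT x|lebesgue. norm (f x))" by (rule norm_fourier_le)
    also have "\<dots> = A" unfolding A_def by (rule integral_completion) measurable
    finally show ?thesis .
  qed
  have prod_int: "integrable lborel (\<lambda>x. g x * cnj (h x))"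
    if g: "integrable lborel g" and h: "h \<in> borel_measurable borel" "\<And>x. norm (h x) \<le> B"
    for g h :: "'a \<Rightarrow> complex" and B
  proof -
    have [measurable]: "g \<in> borel_measurable borel" "h \<in> borel_measurable borel" using g h by auto
    have cb: "(\<lambda>x. cnj (h x)) \<in> borel_measurable borel"
      by (intro measurable_compose[OF h(1) borel_measurable_continuous_onI]) (intro continuous_intros)
    show ?thesis
    proof (rule Bochner_Integration.integrable_bound[OF integrable_mult_left[OF g, of "complex_of_real B"]])
      show "AE x in lborel. norm (g x * cnj (h x)) \<le> norm (g x * complex_of_real B)"
        using h(2) order_trans[OF norm_ge_zero h(2)]
        by (intro AE_I2) (auto simp: norm_mult intro!: mult_left_mono order_trans[OF h(2)])
    qed (use cb in measurable)
  qed
  define w where "w x = (norm (f x))\<^sup>2" for x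
  have w_cnj: "complex_of_real (w x) = f x * cnj (f x)" for x
    unfolding w_def by (rule complex_norm_square)
  have w0: "w x \<ge> 0" for x by (simp add: w_def)
  have wm[measurable]: "w \<in> borel_measurable borel" unfolding w_def by measurable
  have "integrable lborel (\<lambda>x. f x * cnj (f x))"
    by (rule prod_int[OF int _ bound]) measurable
  then have wi: "integrable lborel w"
    by (simp only: w_cnj[symmetric] complex_of_real_integrable_eq)
  obtain e :: 'a where e: "e \<in> Basis" using nonempty_Basis by blast
  then have e0: "e \<noteq> 0" by auto
  \<comment> \<open>The dimension of the test space, chosen to violate the bound \<open>|U| |F|\<close>.\<close>
  define N where "N = Suc (nat \<lceil>(measure lborel F + 1) * measure lborel F\<rceil>)"
  have N: "(measure lborel F + 1) * measure lborel F < real N"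
    unfolding N_def by linarith
  obtain t where t: "t > 0"
    and Ufin: "emeasure lborel (\<Union>j<N. {x. x - (real j * t) *\<^sub>R e \<in> F}) < \<infinity>"
    and Um: "measure lborel (\<Union>j<N. {x. x - (real j * t) *\<^sub>R e \<in> F}) \<le> measure lborel F + 1"
    using small_translations[OF \<open>open F\<close>, of e N] fin unfolding F_def by blast
  define U where "U = (\<Union>j<N. {x. x - (real j * t) *\<^sub>R e \<in> F})"
  have Ub[measurable]: "U \<in> sets borel"
  proof -
    have "{x. x - (real j * t) *\<^sub>R e \<in> F} = (\<lambda>x. x - (real j * t) *\<^sub>R e) -` F" for j by auto
    then have "open {x. x - (real j * t) *\<^sub>R e \<in> F}" for j
      using \<open>open F\<close> by (auto intro!: open_vimage continuous_intros)
    then show ?thesis unfolding U_def by (intro borel_open open_UN) auto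
  qed
  define z where "z x = cis (2 * pi * (t * (e \<bullet> x)))" for x
  have zc: "continuous_on UNIV z" unfolding z_def by (intro continuous_intros)
  have zpow: "cis (2 * pi * (((real j * t) *\<^sub>R e) \<bullet> x)) = z x ^ j" for j x
    unfolding z_def Complex.DeMoivre by (simp add: mult_ac)
  have nz: "norm (z x) = 1" for x by (simp add: z_def)
  define h where "h j x = f (x - (real j * t) *\<^sub>R e)" for j x
  have hi: "integrable lborel (h j)" for j
    unfolding h_def by (rule lborel_integrable_translate[OF int])
  have hm[measurable]: "h j \<in> borel_measurable borel" for j using hi by auto
  have hb: "norm (h j x) \<le> A" for j x by (simp add: h_def bound)
  have hU: "h j x = 0" if "x \<notin> U" "j < N" for j x
    using that by (auto simp: h_def U_def F_def)

  \<comment> \<open>The inner product of combinations of translates, written on the frequency side, where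
    it is visibly positive definite.\<close>
  define B where "B p q = (LINT x|lborel. poly p (z x) * cnj (poly q (z x)) * complex_of_real (w x))" for p q
  have Bint: "integrable lborel (\<lambda>x. poly p (z x) * cnj (poly q (z x)) * complex_of_real (w x))" for p q
  proof -
    have bd: "\<exists>b. \<forall>x. norm (poly p (z x)) \<le> b" for p :: "complex poly"
    proof -
      have "compact (poly p ` sphere 0 1)"
        by (intro compact_continuous_image continuous_intros compact_sphere)
      then obtain b where "\<And>y. y \<in> poly p ` sphere 0 1 \<Longrightarrow> norm y \<le> b"
        using compact_imp_bounded bounded_iff by metis
      then show ?thesis using nz by (intro exI[of _ b]) auto
    qed
    obtain b1 where b1: "\<And>x. norm (poly p (z x)) \<le> b1" using bd by blast
    obtain b2 where b2: "\<And>x. norm (poly q (z x)) \<le> b2" using bd by blast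
    have m: "(\<lambda>x. poly p (z x) * cnj (poly q (z x))) \<in> borel_measurable borel"
      by (intro borel_measurable_continuous_onI continuous_intros zc)
    show ?thesis
    proof (rule Bochner_Integration.integrable_bound[OF integrable_mult_right[OF wi, of "b1 * b2"]])
      show "AE x in lborel. norm (poly p (z x) * cnj (poly q (z x)) * complex_of_real (w x)) \<le> norm (b1 * b2 * w x)"
      proof (rule AE_I2)
        fix x
        have "norm (poly p (z x)) * norm (poly q (z x)) * w x \<le> b1 * b2 * w x"
          using b1[of x] b2[of x] order_trans[OF norm_ge_zero b1[of x]]
          by (intro mult_right_mono mult_mono) (auto simp: w_def)
        also have "\<dots> \<le> norm (b1 * b2 * w x)" by simp
        finally show "norm (poly p (z x) * cnj (poly q (z x)) * complex_of_real (w x)) \<le> norm (b1 * b2 * w x)"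
          using w0[of x] by (simp add: norm_mult)
      qed
    qed (use m in measurable)
  qed
  have Bpos: "\<exists>r>0. B p p = complex_of_real r" if "p \<noteq> 0" for p
  proof -
    define r where "r = (LINT x|lborel. (norm (poly p (z x)))\<^sup>2 * w x)"
    have pm: "poly p (z x) * cnj (poly p (z x)) * complex_of_real (w x) = complex_of_real ((norm (poly p (z x)))\<^sup>2 * w x)" for x
      by (simp only: complex_norm_square of_real_mult)
    have ri: "integrable lborel (\<lambda>x. (norm (poly p (z x)))\<^sup>2 * w x)"
      using Bint[of p p] unfolding pm by (simp only: complex_of_real_integrable_eq)
    have Br: "B p p = complex_of_real r"
      unfolding B_def r_def pm by (rule integral_complex_of_real)
    have "r \<ge> 0" unfolding r_def by (simp add: w_def)
    moreover have "r \<noteq> 0"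
    proof
      assume "r = 0"
      then have "AE x in lborel. (norm (poly p (z x)))\<^sup>2 * w x = 0"
        unfolding r_def using ri by (subst (asm) integral_nonneg_eq_0_iff_AE) (auto simp: w_def)
      moreover have "AE x in lborel. poly p (z x) \<noteq> 0"
        using AE_not_in[OF negligible_trigonometric_zeros[OF that _ e0, of t]] t by (simp add: z_def)
      ultimately have "AE x in lborel. x \<notin> F"
        by eventually_elim (auto simp: w_def F_def)
      then show False using Fpos by (simp add: AE_iff_null_sets)
    qed
    ultimately show ?thesis using Br by (intro exI[of _ r]) auto
  qed
  have Bherm: "B q p = cnj (B p q)" for p q
  proof -
    have "B q p = (LINT x|lborel. cnj (poly p (z x) * cnj (poly q (z x)) * complex_of_real (w x)))"
      unfolding B_def by (simp add: mult_ac)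
    then show ?thesis unfolding B_def by (simp only: Bochner_Integration.integral_cnj)
  qed
  have Badd: "B (p + q) s = B p s + B q s" for p q s
    unfolding B_def using Bint by (simp add: distrib_right)
  have Bscale: "B (smult a p) q = a * B p q" for a p q
    unfolding B_def by (simp add: mult.assoc)
  obtain p where deg: "\<And>m. m < N \<Longrightarrow> degree (p m) < N"
    and orth: "\<And>m n. m < N \<Longrightarrow> n < N \<Longrightarrow> B (p m) (p n) = (if m = n then 1 else 0)"
    using polynomial_gram_schmidt[of B N, OF Badd Bscale Bherm Bpos] by blast

  \<comment> \<open>Up to a fixed unimodular factor \<open>\<kappa>\<close>, inner products of translates are inner products of
    powers of \<open>z\<close>. The case of equal translates compares a positive number with itself, so
    \<open>\<kappa> = 1\<close>: this takes the place of Plancherel's theorem.\<close>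
  define \<kappa> where "\<kappa> = cnj c * cnj \<epsilon> / c"
  have c0: "c \<noteq> 0" using c by auto
  have hh: "(LINT x|lborel. h j x * cnj (h k x)) = \<kappa> * (LINT x|lborel. z x ^ j * cnj (z x ^ k) * complex_of_real (w x))" for j k
    using eigenfunction_translates_inner_product[OF int eig c parity, of "(real j * t) *\<^sub>R e" "(real k * t) *\<^sub>R e"] c0
    unfolding zpow h_def[symmetric] w_cnj[symmetric] \<kappa>_def by (simp add: field_simps)
  have "\<kappa> = 1"
  proof -
    have "B 1 1 = \<kappa> * B 1 1"
      using hh[of 0 0] unfolding B_def by (simp add: h_def w_cnj)
    moreover have "B 1 1 \<noteq> 0" using Bpos[of 1] by auto
    ultimately show ?thesis by simp
  qed

  \<comment> \<open>The orthonormal system in space that corresponds to the orthonormal polynomials.\<close>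
  define u where "u m x = (\<Sum>j<N. coeff (p m) j * h j x)" for m x
  have ui: "integrable lborel (u m)" for m
    unfolding u_def by (intro Bochner_Integration.integrable_sum integrable_mult_right hi)
  have um[measurable]: "u m \<in> borel_measurable borel" for m using ui by auto
  have ub: "norm (u m x) \<le> (\<Sum>j<N. norm (coeff (p m) j) * A)" for m x
    unfolding u_def by (rule order_trans[OF norm_sum]) (auto simp: norm_mult intro!: sum_mono mult_left_mono hb)
  have uU: "u m x = 0" if "x \<notin> U" for m x
    unfolding u_def using hU[OF that] by (intro sum.neutral) auto
  have poly_p: "poly (p m) y = (\<Sum>j<N. coeff (p m) j * y ^ j)" if "m < N" for m y
  proof -
    have "(\<Sum>j\<le>degree (p m). coeff (p m) j * y ^ j) = (\<Sum>j<N. coeff (p m) j * y ^ j)"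
      using deg[OF that] by (intro sum.mono_neutral_left) (auto simp: coeff_eq_0)
    then show ?thesis by (simp add: poly_altdef)
  qed
  have zi: "integrable lborel (\<lambda>x. z x ^ j * cnj (z x ^ k) * complex_of_real (w x))" for j k
    using Bint[of "monom 1 j" "monom 1 k"] by (simp add: poly_monom)
  have hhi: "integrable lborel (\<lambda>x. h j x * cnj (h k x))" for j k
    by (rule prod_int[OF hi hm hb])
  have uorth: "(LINT x|lborel. u m x * cnj (u n x)) = (if m = n then 1 else 0)" if "m < N" "n < N" for m n
  proof -
    have "(LINT x|lborel. u m x * cnj (u n x))
      = (LINT x|lborel. (\<Sum>j<N. \<Sum>k<N. coeff (p m) j * cnj (coeff (p n) k) * (h j x * cnj (h k x))))"
      by (simp add: u_def sum_product mult_ac)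
    also have "\<dots> = (\<Sum>j<N. \<Sum>k<N. coeff (p m) j * cnj (coeff (p n) k) * (LINT x|lborel. h j x * cnj (h k x)))"
      using hhi by (simp add: Bochner_Integration.integral_sum)
    also have "\<dots> = (\<Sum>j<N. \<Sum>k<N. coeff (p m) j * cnj (coeff (p n) k) * (LINT x|lborel. z x ^ j * cnj (z x ^ k) * complex_of_real (w x)))"
      by (simp add: hh \<open>\<kappa> = 1\<close>)
    also have "\<dots> = (LINT x|lborel. (\<Sum>j<N. \<Sum>k<N. coeff (p m) j * cnj (coeff (p n) k) * (z x ^ j * cnj (z x ^ k) * complex_of_real (w x))))"
      using zi by (simp add: Bochner_Integration.integral_sum del: complex_cnj_power)
    also have "\<dots> = B (p m) (p n)"
      unfolding B_def poly_p[OF that(1)] poly_p[OF that(2)] cnj_sum sum_product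
      unfolding sum_distrib_right by (simp add: mult_ac)
    finally show ?thesis using orth that by simp
  qed

  have pointwise: "(\<Sum>m<N. (norm (poly (p m) (z \<xi>)))\<^sup>2 * w \<xi>) \<le> (measure lborel F + 1) * indicator F \<xi>" for \<xi>
  proof -
    \<comment> \<open>The coefficient of \<open>\<phi>\<close> against \<open>u m\<close> is the transform of \<open>u m\<close> at \<open>- \<xi>\<close>, since
      \<open>u m\<close> vanishes off \<open>U\<close>.\<close>
    define \<phi> where "\<phi> x = indicator U x * cis (- (2 * pi * (x \<bullet> \<xi>)))" for x
    have \<phi>m[measurable]: "\<phi> \<in> borel_measurable borel"
      unfolding \<phi>_def using cis_inner_measurable_lborel[of "- (2 * pi)" \<xi>] by simp
    have \<phi>n: "(norm (\<phi> x))\<^sup>2 = indicator U x" for x by (simp add: \<phi>_def norm_mult indicator_def)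
    have "(\<Sum>m<N. (norm (LINT x|lborel. u m x * cnj (\<phi> x)))\<^sup>2) \<le> (LINT x|lborel. (norm (\<phi> x))\<^sup>2)"
    proof (rule bessel_inequality)
      show "integrable lborel (\<lambda>x. \<phi> x * cnj (\<phi> x))"
        unfolding complex_norm_square[symmetric] \<phi>n
        using Ufin by (simp add: U_def[symmetric] complex_of_real_integrable_eq integrable_real_indicator)
      show "integrable lborel (\<lambda>x. u m x * cnj (\<phi> x))" for m
        by (rule prod_int[OF ui \<phi>m, of 1]) (simp add: \<phi>_def norm_mult indicator_def)
      show "integrable lborel (\<lambda>x. u m x * cnj (u n x))" for m n
        by (rule prod_int[OF ui um ub])
    qed (use uorth in auto)
    also have "\<dots> = measure lborel U" unfolding \<phi>n by simp
    also have "\<dots> \<le> measure lborel F + 1" using Um by (simp add: U_def)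
    finally have bes: "(\<Sum>m<N. (norm (LINT x|lborel. u m x * cnj (\<phi> x)))\<^sup>2) \<le> measure lborel F + 1" .
    have "(norm (LINT x|lborel. u m x * cnj (\<phi> x)))\<^sup>2 = (norm (poly (p m) (z \<xi>)))\<^sup>2 * w \<xi>" if "m < N" for m
    proof -
      have hF: "fourier (h j) (- \<xi>) = z \<xi> ^ j * (c * (\<epsilon> * f \<xi>))" for j
        unfolding h_def by (simp add: fourier_translate eig parity zpow[symmetric])
      have hFi: "integrable lborel (\<lambda>x. cis (- (2 * pi * (x \<bullet> (- \<xi>)))) * h j x)" for j
        using prod_int[OF hi, of "\<lambda>x. cis (- (2 * pi * (x \<bullet> \<xi>)))" 1 j]
          cis_inner_measurable_lborel[of "- (2 * pi)" \<xi>] by (simp add: cis_cnj mult.commute)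
      have "(LINT x|lborel. u m x * cnj (\<phi> x)) = (LINT x|lborel. (\<Sum>j<N. coeff (p m) j * (cis (- (2 * pi * (x \<bullet> (- \<xi>)))) * h j x)))"
      proof (intro Bochner_Integration.integral_cong refl)
        fix x
        have eq: "u m x * cnj (\<phi> x) = u m x * cis (2 * pi * (x \<bullet> \<xi>))"
          using uU[of x m] by (auto simp: \<phi>_def indicator_def cis_cnj)
        show "u m x * cnj (\<phi> x) = (\<Sum>j<N. coeff (p m) j * (cis (- (2 * pi * (x \<bullet> (- \<xi>)))) * h j x))"
          unfolding eq unfolding u_def sum_distrib_right by (simp add: mult_ac)
      qed
      also have "\<dots> = (\<Sum>j<N. coeff (p m) j * fourier (h j) (- \<xi>))"
        using hFi by (simp add: Bochner_Integration.integral_sum fourier_lborel)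
      also have "\<dots> = poly (p m) (z \<xi>) * (c * (\<epsilon> * f \<xi>))"
        unfolding hF poly_p[OF that] sum_distrib_right by (simp add: mult_ac)
      finally show ?thesis by (simp add: norm_mult c eps w_def power_mult_distrib)
    qed
    with bes have "(\<Sum>m<N. (norm (poly (p m) (z \<xi>)))\<^sup>2 * w \<xi>) \<le> measure lborel F + 1" by simp
    then show ?thesis
      by (cases "\<xi> \<in> F") (auto simp: F_def w_def)
  qed
  have ni: "integrable lborel (\<lambda>x. (norm (poly (p m) (z x)))\<^sup>2 * w x)" for m
    using Bint[of "p m" "p m"]
    by (simp only: complex_norm_square[symmetric] of_real_mult[symmetric] complex_of_real_integrable_eq)
  have n1: "(LINT x|lborel. (norm (poly (p m) (z x)))\<^sup>2 * w x) = 1" if "m < N" for m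
  proof -
    have "complex_of_real (LINT x|lborel. (norm (poly (p m) (z x)))\<^sup>2 * w x) = 1"
      using orth[OF that that] unfolding B_def
      by (simp only: complex_norm_square[symmetric] of_real_mult[symmetric] integral_complex_of_real if_True simp_thms)
    then show ?thesis by simp
  qed
  have "real N = (\<Sum>m<N. LINT x|lborel. (norm (poly (p m) (z x)))\<^sup>2 * w x)"
    by (simp add: n1)
  also have "\<dots> = (LINT x|lborel. (\<Sum>m<N. (norm (poly (p m) (z x)))\<^sup>2 * w x))"
    using ni by (simp add: Bochner_Integration.integral_sum)
  also have "\<dots> \<le> (LINT x|lborel. (measure lborel F + 1) * indicator F x)"
    using ni pointwise fin by (intro integral_mono) (auto simp: F_def[symmetric] intro!: integrable_real_indicator)
  also have "\<dots> = (measure lborel F + 1) * measure lborel F"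
    by simp
  finally show False using N by simp
qed

text \<open>After replacing \<open>g\<close> by the continuous function \<open>fourier g / c\<close> one splits it into its even and
odd parts, which are eigenfunctions because the transform commutes with reflection.\<close>

lemma eigenfunction_finite_support:
  fixes g :: "'a::euclidean_space \<Rightarrow> complex"
  assumes int: "integrable lebesgue g" and c: "norm c = 1"
    and eig: "AE x in lebesgue. fourier g x = c * g x"
    and A: "A \<in> sets lebesgue" "emeasure lebesgue A < \<infinity>"
    and supp: "AE x in lebesgue. x \<notin> A \<longrightarrow> g x = 0"
  shows "AE x in lebesgue. g x = 0"
proof -
  have c0: "c \<noteq> 0" using c by auto
  define f where "f x = fourier g x / c" for x
  have cont: "continuous_on UNIV f"
    unfolding f_def using continuous_fourier[OF int] c0 by (intro continuous_intros) auto
  have fb[measurable]: "f \<in> borel_measurable borel"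
    by (rule borel_measurable_continuous_onI[OF cont])
  have fl: "f \<in> borel_measurable lebesgue" using fb by (auto intro!: measurable_completion)
  have fg: "AE x in lebesgue. f x = g x"
    using eig by eventually_elim (simp add: f_def c0)
  have fi: "integrable lebesgue f"
    by (rule integrable_cong_AE_imp[OF int fl]) (use fg in \<open>auto elim!: eventually_mono\<close>)
  then have fi': "integrable lborel f"
    using integrable_completion[of f lborel] fb by simp
  have f_eig: "fourier f x = c * f x" for x
    using fourier_cong_AE[OF fi int fg, of x] f_def[of x] c0 by simp
  have fsupp: "emeasure lborel {x. f x \<noteq> 0} < \<infinity>"
  proof -
    have [measurable]: "{x. f x \<noteq> 0} \<in> sets borel"
      using open_Collect_neq[OF cont continuous_on_const] by auto
    have "AE x in lebesgue. x \<in> {x. f x \<noteq> 0} \<longrightarrow> x \<in> A"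
      using fg supp by eventually_elim auto
    then have "emeasure lebesgue {x. f x \<noteq> 0} \<le> emeasure lebesgue A"
      by (rule emeasure_mono_AE) (use A in auto)
    then show ?thesis using A by (simp add: emeasure_completion)
  qed
  have "f x + \<epsilon> * f (- x) = 0" if e: "\<epsilon> \<in> {1, -1}" for \<epsilon> x
  proof -
    define k where "k x = f x + \<epsilon> * f (- x)" for x
    have fr: "integrable lborel (\<lambda>x. f (- x))" by (rule lborel_integrable_reflect[OF fi'])
    have fcr: "continuous_on UNIV (\<lambda>x. f (- x))"
      by (rule continuous_on_compose2[OF cont]) (auto intro!: continuous_intros)
    show ?thesis
      unfolding k_def[symmetric]
    proof (rule eigenfunction_finite_support_parity[where c = c and \<epsilon> = \<epsilon> and f = k])
      show "integrable lborel k"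
        unfolding k_def using fi' fr by simp
      show "continuous_on UNIV k"
        unfolding k_def using cont fcr by (intro continuous_intros)
      show "norm \<epsilon> = 1" using e by auto
      show "k (- x) = \<epsilon> * k x" for x using e by (auto simp: k_def)
      show "fourier k \<xi> = c * k \<xi>" for \<xi>
      proof -
        have fr': "integrable lebesgue (\<lambda>x. f (- x))"
          using fr integrable_completion[of "\<lambda>x. f (- x)" lborel] by simp
        have "integrable lebesgue (\<lambda>x. - \<epsilon> * f (- x))" using fr' by simp
        from fourier_diff[OF fi this]
        have "fourier k \<xi> = fourier f \<xi> - fourier (\<lambda>x. - \<epsilon> * f (- x)) \<xi>" by (simp add: k_def[abs_def])
        then show ?thesis
          unfolding fourier_cmult by (simp add: fourier_reflect f_eig k_def distrib_left mult_ac)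
      qed
      show "emeasure lborel {x. k x \<noteq> 0} < \<infinity>"
      proof -
        have F: "{x. f x \<noteq> 0} \<in> sets borel"
          using open_Collect_neq[OF cont continuous_on_const] by auto
        have F': "{x. f (- x) \<noteq> 0} \<in> sets borel"
          using open_Collect_neq[OF fcr continuous_on_const] by auto
        have "emeasure lborel {x. f x \<noteq> 0} = emeasure (distr lborel borel uminus) {x. f x \<noteq> 0}"
          by (simp add: distr_uminus_lborel)
        also have "\<dots> = emeasure lborel (uminus -` {x. f x \<noteq> 0} \<inter> space lborel)"
          using F by (intro emeasure_distr) auto
        finally have e': "emeasure lborel {x. f (- x) \<noteq> 0} = emeasure lborel {x. f x \<noteq> 0}"
          by (simp add: vimage_def)
        have "emeasure lborel {x. k x \<noteq> 0} \<le> emeasure lborel ({x. f x \<noteq> 0} \<union> {x. f (- x) \<noteq> 0})"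
          using F F' by (intro emeasure_mono) (auto simp: k_def)
        also have "\<dots> \<le> emeasure lborel {x. f x \<noteq> 0} + emeasure lborel {x. f (- x) \<noteq> 0}"
          using F F' by (intro emeasure_subadditive) auto
        also have "\<dots> < \<infinity>" using fsupp e' by simp
        finally show ?thesis .
      qed
    qed (rule c)
  qed
  from this[of 1] this[of "-1"] have "f x = 0" for x
    by (simp add: eq_neg_iff_add_eq_0)
  then show ?thesis using fg by simp
qed

section \<open>Compactness and the uncertainty inequality\<close>

lemma AE_norm_eigenfunction_le:
  assumes "AE x in lebesgue. fourier f x = c * f x" "norm c = 1"
  shows "AE x in lebesgue. norm (f x) \<le> (LINT x|lebesgue. norm (f x))"
  using assms(1)
proof eventually_elim
  case (elim x)
  then have "norm (f x) = norm (fourier f x)" using assms(2) by (simp add: norm_mult)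
  then show ?case using norm_fourier_le[of f x] by simp
qed

text \<open>A compactness argument that needs no weak topology: the eigenfunction equation upgrades pointwise
convergence of transforms to almost everywhere convergence of the functions themselves.\<close>

lemma eigenfunction_annihilating:
  fixes A :: "'a::euclidean_space set"
  assumes A: "A \<in> sets lebesgue" "emeasure lebesgue A < \<infinity>" and c: "norm c = 1"
  shows "\<exists>C>0. \<forall>f. integrable lebesgue f \<longrightarrow> (AE x in lebesgue. fourier f x = c * f x) \<longrightarrow>
    (LINT x|lebesgue. norm (f x)) \<le> C * (LINT x|lebesgue. indicator (- A) x * norm (f x))"
proof (rule ccontr)
  assume contra: "\<not> ?thesis"
  have c0: "c \<noteq> 0" using c by auto
  have Am[measurable]: "A \<in> sets lebesgue" by (rule A)
  define R where "R f = (LINT x|lebesgue. indicator (- A) x * norm (f x))" for f :: "'a \<Rightarrow> complex"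
  have "\<forall>n. \<exists>f. integrable lebesgue f \<and> (AE x in lebesgue. fourier f x = c * f x) \<and>
    real (Suc n) * R f < (LINT x|lebesgue. norm (f x))"
  proof
    fix n
    have "real (Suc n) > 0" by simp
    then show "\<exists>f. integrable lebesgue f \<and> (AE x in lebesgue. fourier f x = c * f x) \<and>
        real (Suc n) * R f < (LINT x|lebesgue. norm (f x))"
      using contra unfolding R_def[symmetric] not_le[symmetric] by blast
  qed
  from choice[OF this] obtain f0 where f0: "\<forall>n. integrable lebesgue (f0 n) \<and>
    (AE x in lebesgue. fourier (f0 n) x = c * f0 n x) \<and> real (Suc n) * R (f0 n) < (LINT x|lebesgue. norm (f0 n x))" ..
  have f0i: "integrable lebesgue (f0 n)"
    and f0e: "AE x in lebesgue. fourier (f0 n) x = c * f0 n x"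
    and f0l: "real (Suc n) * (LINT x|lebesgue. indicator (- A) x * norm (f0 n x)) < (LINT x|lebesgue. norm (f0 n x))" for n
    using f0[rule_format, of n] unfolding R_def by blast+
  define L where "L n = (LINT x|lebesgue. norm (f0 n x))" for n
  have Lpos: "L n > 0" for n
  proof -
    have "0 \<le> real (Suc n) * (LINT x|lebesgue. indicator (- A) x * norm (f0 n x))"
      by (intro mult_nonneg_nonneg integral_nonneg_AE) auto
    then show ?thesis unfolding L_def using f0l[of n] by (rule le_less_trans)
  qed
  define f where "f n x = complex_of_real (1 / L n) * f0 n x" for n x
  have fi: "integrable lebesgue (f n)" for n
    unfolding f_def using f0i by simp
  have fm: "f n \<in> borel_measurable lebesgue" for n using fi by auto
  have fe: "AE x in lebesgue. fourier (f n) x = c * f n x" for n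
    using f0e[of n] unfolding f_def[abs_def] fourier_cmult by eventually_elim simp
  have norm_f: "norm (f n x) = 1 / L n * norm (f0 n x)" for n x
    using Lpos[of n] by (simp add: f_def norm_mult norm_divide)
  have f1: "(LINT x|lebesgue. norm (f n x)) = 1" for n
    unfolding norm_f using Lpos[of n] by (simp add: L_def[symmetric])
  have fs: "(LINT x|lebesgue. indicator (- A) x * norm (f n x)) < 1 / real (Suc n)" for n
  proof -
    have "(LINT x|lebesgue. indicator (- A) x * norm (f n x)) = 1 / L n * (LINT x|lebesgue. indicator (- A) x * norm (f0 n x))"
      unfolding norm_f mult.left_commute[of _ "1 / L n"] by (rule integral_mult_right_zero)
    also have "\<dots> < 1 / L n * (L n / real (Suc n))"
      using f0l[of n] Lpos[of n] by (intro mult_strict_left_mono) (auto simp: L_def field_simps)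
    finally show ?thesis using Lpos[of n] by simp
  qed
  have fb: "AE x in lebesgue. norm (f n x) \<le> 1" for n
    using AE_norm_eigenfunction_le[OF fe c, of n] by (simp add: f1)
  define fA where "fA n x = indicator A x * f n x" for n x
  have fAm: "fA n \<in> borel_measurable lebesgue" for n
    unfolding fA_def by (intro borel_measurable_times borel_measurable_indicator Am fm)
  have fAi: "integrable lebesgue (fA n)" for n
    by (rule Bochner_Integration.integrable_bound[OF fi fAm]) (auto simp: fA_def norm_mult indicator_def)
  have fA_le: "(LINT x|lebesgue. norm (fA n x)) \<le> 1" for n
    unfolding f1[of n, symmetric]
    by (intro integral_mono integrable_norm fi fAi) (auto simp: fA_def norm_mult indicator_def)
  define G where "G n = fourier (fA n)" for n
  have G1: "norm (G n \<xi>) \<le> 1" for n \<xi>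
    unfolding G_def using norm_fourier_le fA_le order_trans by blast
  have fGdiff: "norm (fourier (f n) \<xi> - G n \<xi>) \<le> 1 / real (Suc n)" for n \<xi>
  proof -
    have "norm (fourier (f n) \<xi> - G n \<xi>) = norm (fourier (\<lambda>x. f n x - fA n x) \<xi>)"
      unfolding G_def using fourier_diff[OF fi fAi] by simp
    also have "\<dots> \<le> (LINT x|lebesgue. norm (f n x - fA n x))" by (rule norm_fourier_le)
    also have "\<dots> = (LINT x|lebesgue. indicator (- A) x * norm (f n x))"
      by (intro Bochner_Integration.integral_cong) (auto simp: fA_def indicator_def)
    finally show ?thesis using fs[of n] by simp
  qed

  \<comment> \<open>A modulus of continuity at \<open>\<xi>\<close> common to all transforms \<open>G n\<close>; it exists because
    \<open>|f n| \<le> 1\<close> and \<open>A\<close> has finite measure.\<close>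
  define \<omega> where "\<omega> \<xi> \<eta> = (LINT x|lebesgue. indicator A x * norm (cis (- (2 * pi * (x \<bullet> \<xi>))) - cis (- (2 * pi * (x \<bullet> \<eta>)))))" for \<xi> \<eta> :: 'a
  have Ai: "integrable lebesgue (\<lambda>x. 2 * indicator A x :: real)"
    using A by (intro integrable_mult_right integrable_real_indicator) auto
  have \<omega>m: "(\<lambda>x. indicator A x * norm (cis (- (2 * pi * (x \<bullet> \<xi>))) - cis (- (2 * pi * (x \<bullet> \<eta>))))) \<in> borel_measurable lebesgue"
    for \<xi> \<eta> :: 'a
    by measurable
  have \<omega>b: "norm (indicator A x * norm (cis (- (2 * pi * (x \<bullet> \<xi>))) - cis (- (2 * pi * (x \<bullet> \<eta>))))) \<le> 2 * indicator A x"
    for x \<xi> \<eta> :: 'a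
    using norm_triangle_ineq4[of "cis (- (2 * pi * (x \<bullet> \<xi>)))" "cis (- (2 * pi * (x \<bullet> \<eta>)))"]
    by (auto simp: indicator_def)
  have \<omega>i: "integrable lebesgue (\<lambda>x. indicator A x * norm (cis (- (2 * pi * (x \<bullet> \<xi>))) - cis (- (2 * pi * (x \<bullet> \<eta>)))))"
    for \<xi> \<eta> :: 'a
    by (rule Bochner_Integration.integrable_bound[OF Ai \<omega>m]) (use \<omega>b in \<open>auto simp: abs_mult\<close>)
  have equicont: "norm (G n \<xi> - G n \<eta>) \<le> \<omega> \<xi> \<eta>" for n \<xi> \<eta>
  proof -
    have "G n \<xi> - G n \<eta> = (LINT x|lebesgue. cis (- (2 * pi * (x \<bullet> \<xi>))) * fA n x - cis (- (2 * pi * (x \<bullet> \<eta>))) * fA n x)"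
      unfolding G_def fourier_eq_cis
      by (rule Bochner_Integration.integral_diff[symmetric]) (intro integrable_character_mult fAi)+
    also have "norm \<dots> \<le> (LINT x|lebesgue. norm (cis (- (2 * pi * (x \<bullet> \<xi>))) * fA n x - cis (- (2 * pi * (x \<bullet> \<eta>))) * fA n x))"
      by (rule integral_norm_bound)
    also have "\<dots> \<le> \<omega> \<xi> \<eta>"
      unfolding \<omega>_def
    proof (rule integral_mono_AE)
      show "integrable lebesgue (\<lambda>x. norm (cis (- (2 * pi * (x \<bullet> \<xi>))) * fA n x - cis (- (2 * pi * (x \<bullet> \<eta>))) * fA n x))"
        by (intro integrable_norm Bochner_Integration.integrable_diff integrable_character_mult fAi)
      show "AE x in lebesgue. norm (cis (- (2 * pi * (x \<bullet> \<xi>))) * fA n x - cis (- (2 * pi * (x \<bullet> \<eta>))) * fA n x)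
          \<le> indicator A x * norm (cis (- (2 * pi * (x \<bullet> \<xi>))) - cis (- (2 * pi * (x \<bullet> \<eta>))))"
        using fb[of n]
      proof eventually_elim
        case (elim x)
        have "norm (cis (- (2 * pi * (x \<bullet> \<xi>))) * fA n x - cis (- (2 * pi * (x \<bullet> \<eta>))) * fA n x)
          = norm (cis (- (2 * pi * (x \<bullet> \<xi>))) - cis (- (2 * pi * (x \<bullet> \<eta>)))) * norm (fA n x)"
          by (simp only: left_diff_distrib[symmetric] norm_mult)
        also have "\<dots> \<le> norm (cis (- (2 * pi * (x \<bullet> \<xi>))) - cis (- (2 * pi * (x \<bullet> \<eta>)))) * indicator A x"
          using elim by (intro mult_left_mono) (auto simp: fA_def indicator_def)
        finally show ?case by (simp only: mult.commute)
      qed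
    qed (rule \<omega>i)
    finally show ?thesis .
  qed
  have \<omega>lim: "(\<lambda>i. \<omega> \<xi> (d i)) \<longlonglongrightarrow> 0" if "d \<longlonglongrightarrow> \<xi>" for d \<xi>
  proof -
    have "(\<lambda>i. \<omega> \<xi> (d i)) \<longlonglongrightarrow> (LINT x::'a|lebesgue. 0)"
      unfolding \<omega>_def
    proof (rule integral_dominated_convergence[OF _ \<omega>m Ai])
      show "AE x in lebesgue. (\<lambda>i. indicator A x * norm (cis (- (2 * pi * (x \<bullet> \<xi>))) - cis (- (2 * pi * (x \<bullet> d i))))) \<longlonglongrightarrow> 0"
      proof (rule AE_I2)
        fix x
        have "(\<lambda>i. indicator A x * norm (cis (- (2 * pi * (x \<bullet> \<xi>))) - cis (- (2 * pi * (x \<bullet> d i)))))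
          \<longlonglongrightarrow> indicator A x * norm (cis (- (2 * pi * (x \<bullet> \<xi>))) - cis (- (2 * pi * (x \<bullet> \<xi>))))"
          by (intro tendsto_intros that)
        then show "(\<lambda>i. indicator A x * norm (cis (- (2 * pi * (x \<bullet> \<xi>))) - cis (- (2 * pi * (x \<bullet> d i))))) \<longlonglongrightarrow> 0"
          by simp
      qed
      show "AE x in lebesgue. norm (indicator A x * norm (cis (- (2 * pi * (x \<bullet> \<xi>))) - cis (- (2 * pi * (x \<bullet> d i))))) \<le> 2 * indicator A x" for i
        by (intro AE_I2 \<omega>b)
    qed simp
    then show ?thesis by simp
  qed

  \<comment> \<open>Pointwise convergence on a countable dense set spreads to every point by equicontinuity.\<close>
  from countable_dense_exists[where 'a = 'a] obtain D :: "'a set" where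
    D': "countable D \<and> (\<forall>X. open X \<longrightarrow> X \<noteq> {} \<longrightarrow> (\<exists>d\<in>D. d \<in> X))" ..
  then have D: "countable D" "\<And>X. open X \<Longrightarrow> X \<noteq> {} \<Longrightarrow> \<exists>d\<in>D. d \<in> X" by auto
  obtain k :: "nat \<Rightarrow> nat" where k: "strict_mono k" "\<And>x. x \<in> D \<Longrightarrow> \<exists>l. (\<lambda>n. G (k n) x) \<longlonglongrightarrow> l"
    by (rule function_convergent_subsequence[of D G 1]) (use D(1) G1 in auto)
  have Gconv: "convergent (\<lambda>n. G (k n) \<xi>)" for \<xi>
  proof -
    have "\<forall>i. \<exists>d. d \<in> D \<and> dist \<xi> d < 1 / real (Suc i)"
    proof
      fix i
      have "\<exists>d\<in>D. d \<in> ball \<xi> (1 / real (Suc i))" by (rule D(2)[OF open_ball]) (simp only: ball_eq_empty not_le, simp)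
      then show "\<exists>d. d \<in> D \<and> dist \<xi> d < 1 / real (Suc i)" unfolding mem_ball by blast
    qed
    from choice[OF this] obtain d where d': "\<forall>i. d i \<in> D \<and> dist \<xi> (d i) < 1 / real (Suc i)" ..
    have d: "d i \<in> D" "dist (d i) \<xi> \<le> 1 / real (Suc i)" for i
      using d'[rule_format, of i] by (simp_all only: dist_commute[of "d i" \<xi>] less_imp_le)
    have "(\<lambda>i. dist (d i) \<xi>) \<longlonglongrightarrow> 0"
    proof (rule tendsto_sandwich[OF _ _ tendsto_const])
      show "(\<lambda>i. 1 / real (Suc i)) \<longlonglongrightarrow> 0"
        using LIMSEQ_inverse_real_of_nat by (simp add: inverse_eq_divide)
      show "\<forall>\<^sub>F i in sequentially. dist (d i) \<xi> \<le> 1 / real (Suc i)"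
        by (intro always_eventually allI d(2))
    qed simp
    then have dlim: "d \<longlonglongrightarrow> \<xi>" by (rule iffD2[OF tendsto_dist_iff])
    have "Cauchy (\<lambda>n. G (k n) \<xi>)"
    proof (rule metric_CauchyI)
      fix \<epsilon> :: real assume "\<epsilon> > 0"
      then have "\<forall>\<^sub>F i in sequentially. \<omega> \<xi> (d i) < \<epsilon> / 3"
        using \<omega>lim[OF dlim] by (intro order_tendstoD) auto
      then obtain i where i: "\<omega> \<xi> (d i) < \<epsilon> / 3" by (auto simp: eventually_sequentially)
      from k(2)[OF d(1)] obtain l where "(\<lambda>n. G (k n) (d i)) \<longlonglongrightarrow> l" ..
      then have "Cauchy (\<lambda>n. G (k n) (d i))" by (rule LIMSEQ_imp_Cauchy)
      moreover have "\<epsilon> / 3 > 0" using \<open>\<epsilon> > 0\<close> by simp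
      ultimately obtain M where M: "\<forall>m\<ge>M. \<forall>n\<ge>M. dist (G (k m) (d i)) (G (k n) (d i)) < \<epsilon> / 3"
        using metric_CauchyD[of "\<lambda>n. G (k n) (d i)" "\<epsilon> / 3"] by blast
      have "dist (G (k m) \<xi>) (G (k n) \<xi>) < \<epsilon>" if "m \<ge> M" "n \<ge> M" for m n
      proof -
        have "dist (G (k m) \<xi>) (G (k n) \<xi>) \<le> dist (G (k m) \<xi>) (G (k m) (d i)) + dist (G (k m) (d i)) (G (k n) (d i)) + dist (G (k n) \<xi>) (G (k n) (d i))"
          using dist_triangle[of "G (k m) \<xi>" "G (k n) \<xi>" "G (k m) (d i)"]
            dist_triangle[of "G (k m) (d i)" "G (k n) \<xi>" "G (k n) (d i)"]
            dist_commute[of "G (k n) \<xi>" "G (k n) (d i)"] by linarith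
        then show ?thesis
          using M[rule_format, OF that] equicont[of "k m" \<xi> "d i"] equicont[of "k n" \<xi> "d i"] i
          unfolding dist_norm by linarith
      qed
      then show "\<exists>M. \<forall>m\<ge>M. \<forall>n\<ge>M. dist (G (k m) \<xi>) (G (k n) \<xi>) < \<epsilon>" by blast
    qed
    then show ?thesis by (rule Cauchy_convergent)
  qed

  define F where "F n = f (k n)" for n
  have klim: "(\<lambda>n. 1 / real (Suc (k n))) \<longlonglongrightarrow> 0"
    using LIMSEQ_subseq_LIMSEQ[OF LIMSEQ_inverse_real_of_nat k(1)] by (simp add: inverse_eq_divide o_def)
  have "\<exists>l. (\<lambda>n. fourier (F n) \<xi>) \<longlonglongrightarrow> l" for \<xi>
  proof -
    obtain l where "(\<lambda>n. G (k n) \<xi>) \<longlonglongrightarrow> l" using Gconv[of \<xi>] unfolding convergent_def ..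
    moreover have "(\<lambda>n. fourier (F n) \<xi> - G (k n) \<xi>) \<longlonglongrightarrow> 0"
      by (rule Lim_null_comparison[OF _ klim]) (use fGdiff in \<open>auto simp: F_def\<close>)
    ultimately have "(\<lambda>n. (fourier (F n) \<xi> - G (k n) \<xi>) + G (k n) \<xi>) \<longlonglongrightarrow> 0 + l"
      by (intro tendsto_add)
    then show ?thesis by auto
  qed
  then have "\<forall>\<xi>. \<exists>l. (\<lambda>n. fourier (F n) \<xi>) \<longlonglongrightarrow> l" by blast
  from choice[OF this] obtain H where "\<forall>\<xi>. (\<lambda>n. fourier (F n) \<xi>) \<longlonglongrightarrow> H \<xi>" ..
  then have H: "(\<lambda>n. fourier (F n) \<xi>) \<longlonglongrightarrow> H \<xi>" for \<xi> by blast
  have Fi: "integrable lebesgue (F n)" for n by (simp add: F_def fi)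
  have Fm: "F n \<in> borel_measurable lebesgue" for n by (simp add: F_def fm)
  define h where "h x = H x / c" for x
  have hm: "h \<in> borel_measurable lebesgue"
  proof -
    have "fourier (F n) \<in> borel_measurable borel" for n
      by (rule borel_measurable_continuous_onI[OF continuous_fourier[OF Fi]])
    then have "H \<in> borel_measurable borel"
      by (rule borel_measurable_LIMSEQ_metric) (use H in auto)
    then have "h \<in> borel_measurable borel" unfolding h_def by measurable
    then show ?thesis by (auto intro!: measurable_completion)
  qed
  have Fh: "AE x in lebesgue. (\<lambda>n. F n x) \<longlonglongrightarrow> h x"
  proof -
    have "AE x in lebesgue. \<forall>n. fourier (F n) x = c * F n x"
      unfolding AE_all_countable F_def using fe by blast
    then show ?thesis
    proof eventually_elim
      case (elim x)
      have "(\<lambda>n. fourier (F n) x / c) \<longlonglongrightarrow> H x / c" by (intro tendsto_divide H tendsto_const c0)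
      then show ?case using elim c0 by (simp add: h_def)
    qed
  qed
  define g where "g x = indicator A x * h x" for x
  have gm: "g \<in> borel_measurable lebesgue"
    unfolding g_def by (intro borel_measurable_times borel_measurable_indicator Am hm)
  have h1: "AE x in lebesgue. norm (h x) \<le> 1"
  proof -
    have "AE x in lebesgue. \<forall>n. norm (F n x) \<le> 1"
      unfolding AE_all_countable F_def using fb by blast
    then show ?thesis using Fh
      by eventually_elim (auto intro: Lim_bounded tendsto_norm)
  qed
  have gi: "integrable lebesgue g"
    by (rule Bochner_Integration.integrable_bound[OF Ai gm])
       (use h1 in \<open>eventually_elim, auto simp: g_def indicator_def\<close>)
  have L1A: "(\<lambda>n. LINT x|lebesgue. norm (fA (k n) x - g x)) \<longlonglongrightarrow> 0"
  proof -
    have "(\<lambda>n. LINT x|lebesgue. norm (fA (k n) x - g x)) \<longlonglongrightarrow> (LINT x::'a|lebesgue. 0)"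
    proof (rule integral_dominated_convergence[OF _ _ Ai])
      show "(\<lambda>x. norm (fA (k n) x - g x)) \<in> borel_measurable lebesgue" for n
        using fAm gm by measurable
      show "AE x in lebesgue. (\<lambda>n. norm (fA (k n) x - g x)) \<longlonglongrightarrow> 0"
        using Fh
      proof eventually_elim
        case (elim x)
        have "(\<lambda>n. norm (indicator A x * F n x - indicator A x * h x)) \<longlonglongrightarrow> norm (indicator A x * h x - indicator A x * h x)"
          by (intro tendsto_intros elim)
        then show ?case by (simp add: fA_def g_def F_def)
      qed
      show "AE x in lebesgue. norm (norm (fA (k n) x - g x)) \<le> 2 * indicator A x" for n
        using h1 fb[of "k n"]
      proof eventually_elim
        case (elim x)
        then show ?case using norm_triangle_ineq4[of "f (k n) x" "h x"]
          by (auto simp: fA_def g_def indicator_def)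
      qed
    qed simp
    then show ?thesis by simp
  qed
  \<comment> \<open>On \<open>A\<close> dominated convergence applies; off \<open>A\<close> the mass of \<open>F n\<close> tends to 0.\<close>
  have L1: "(\<lambda>n. LINT x|lebesgue. norm (F n x - g x)) \<longlonglongrightarrow> 0"
  proof (rule Lim_null_comparison)
    show "(\<lambda>n. (LINT x|lebesgue. norm (fA (k n) x - g x)) + 1 / real (Suc (k n))) \<longlonglongrightarrow> 0"
      using tendsto_add[OF L1A klim] by simp
    have "(LINT x|lebesgue. norm (F n x - g x)) \<le> (LINT x|lebesgue. norm (fA (k n) x - g x)) + 1 / real (Suc (k n))" for n
    proof -
      have Ii: "integrable lebesgue (\<lambda>x. indicator (- A) x * norm (F n x))"
      proof (rule Bochner_Integration.integrable_bound[OF Fi[of n]])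
        show "(\<lambda>x. indicator (- A) x * norm (F n x)) \<in> borel_measurable lebesgue"
          using Fm by measurable
      qed (auto simp: indicator_def)
      have "(LINT x|lebesgue. norm (F n x - g x))
          = (LINT x|lebesgue. norm (fA (k n) x - g x) + indicator (- A) x * norm (F n x))"
        by (intro Bochner_Integration.integral_cong) (auto simp: fA_def g_def F_def indicator_def)
      also have "\<dots> = (LINT x|lebesgue. norm (fA (k n) x - g x)) + (LINT x|lebesgue. indicator (- A) x * norm (F n x))"
        using Ii by (intro Bochner_Integration.integral_add integrable_norm Bochner_Integration.integrable_diff fAi gi)
      finally show ?thesis using fs[of "k n"] by (simp add: F_def)
    qed
    then show "\<forall>\<^sub>F n in sequentially. norm (LINT x|lebesgue. norm (F n x - g x))
        \<le> (LINT x|lebesgue. norm (fA (k n) x - g x)) + 1 / real (Suc (k n))"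
      by (intro always_eventually) auto
  qed
  have Fgi: "integrable lebesgue (\<lambda>x. F n x - g x)" for n
    by (intro Bochner_Integration.integrable_diff Fi gi)
  have gh: "AE x in lebesgue. g x = h x"
  proof -
    obtain r where r: "strict_mono r" "AE x in lebesgue. (\<lambda>n. F (r n) x - g x) \<longlonglongrightarrow> 0"
      using tendsto_L1_AE_subseq[OF Fgi L1] by blast
    from r(2) Fh show ?thesis
    proof eventually_elim
      case (elim x)
      have "(\<lambda>n. F (r n) x) \<longlonglongrightarrow> g x" using elim(1) by (simp add: LIM_zero_iff)
      moreover have "(\<lambda>n. F (r n) x) \<longlonglongrightarrow> h x"
        using LIMSEQ_subseq_LIMSEQ[OF elim(2) r(1)] by (simp add: o_def)
      ultimately show ?case by (rule LIMSEQ_unique)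
    qed
  qed
  have gH: "fourier g \<xi> = H \<xi>" for \<xi>
  proof -
    have "(\<lambda>n. fourier (F n) \<xi> - fourier g \<xi>) \<longlonglongrightarrow> 0"
    proof (rule Lim_null_comparison[OF _ L1])
      show "\<forall>\<^sub>F n in sequentially. norm (fourier (F n) \<xi> - fourier g \<xi>) \<le> (LINT x|lebesgue. norm (F n x - g x))"
        unfolding fourier_diff[OF Fi gi, symmetric] by (intro always_eventually allI norm_fourier_le)
    qed
    then have "(\<lambda>n. fourier (F n) \<xi>) \<longlonglongrightarrow> fourier g \<xi>" by (simp add: LIM_zero_iff)
    then show ?thesis by (rule LIMSEQ_unique[OF _ H])
  qed
  have ge: "AE x in lebesgue. fourier g x = c * g x"
    using gh by eventually_elim (simp add: gH h_def c0)
  have "AE x in lebesgue. g x = 0"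
    by (rule eigenfunction_finite_support[OF gi c ge A]) (auto simp: g_def)
  then have g0: "(LINT x|lebesgue. norm (g x)) = 0"
    by (intro integral_eq_zero_AE) auto
  have "1 \<le> (LINT x|lebesgue. norm (F n x - g x))" for n
  proof -
    have "(LINT x|lebesgue. norm (F n x)) \<le> (LINT x|lebesgue. norm (F n x - g x) + norm (g x))"
      using Fi gi Fgi norm_triangle_sub by (intro integral_mono) (auto simp: add.commute)
    also have "\<dots> = (LINT x|lebesgue. norm (F n x - g x)) + (LINT x|lebesgue. norm (g x))"
      using Fgi gi by (intro Bochner_Integration.integral_add integrable_norm)
    finally show ?thesis using g0 f1 by (simp add: F_def)
  qed
  then show False
    using LIMSEQ_le_const[OF L1, of 1] by auto
qed

section \<open>Sub-level sets and the weighted inequality\<close>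

lemma sublevel_measurable:
  assumes "P \<in> borel_measurable lebesgue"
  shows "sublevel P t \<in> sets lebesgue"
proof -
  have "{x \<in> space lebesgue. \<bar>P x\<bar> \<le> t} \<in> sets lebesgue"
    using assms by measurable
  then show ?thesis by (simp add: sublevel_def)
qed

lemma bounds_with_1I:
  assumes "C \<ge> 0"
    and "\<And>f. f \<in> test_functions r P \<Longrightarrow>
      (LINT x|lebesgue. norm (f x)) \<le> C * (LINT x|lebesgue. norm (complex_of_real (P x) * f x))"
  shows "bounds_with r P 1 C"
  unfolding bounds_with_def Lq_norm_1
proof
  fix f assume f: "f \<in> test_functions r P"
  have i: "integrable lebesgue f" "integrable lebesgue (\<lambda>x. complex_of_real (P x) * f x)"
    using f by (auto simp: test_functions_def)
  show "(\<integral>\<^sup>+x. ennreal (norm (f x)) \<partial>lebesgue)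
      \<le> ennreal C * (\<integral>\<^sup>+x. ennreal (norm (complex_of_real (P x) * f x)) \<partial>lebesgue)"
    using assms(1) assms(2)[OF f] nn_integral_eq_integral[OF integrable_norm[OF i(1)]]
      nn_integral_eq_integral[OF integrable_norm[OF i(2)]]
    by (simp add: ennreal_mult'[symmetric] ennreal_leI del: norm_mult)
qed

lemma integrable_indicator_norm:
  fixes f :: "'a::euclidean_space \<Rightarrow> complex"
  assumes "A \<in> sets lebesgue" "integrable lebesgue f"
  shows "integrable lebesgue (\<lambda>x. indicator A x * norm (f x))"
proof (rule Bochner_Integration.integrable_bound[OF assms(2)])
  show "(\<lambda>x. indicator A x * norm (f x)) \<in> borel_measurable lebesgue"
    using assms by measurable
qed (auto simp: indicator_def)

lemma integral_off_sublevel_le: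
  assumes P: "P \<in> borel_measurable lebesgue" and t: "t > 0"
    and f: "integrable lebesgue f" "integrable lebesgue (\<lambda>x. complex_of_real (P x) * f x)"
  shows "(LINT x|lebesgue. indicator (- sublevel P t) x * norm (f x))
    \<le> 1 / t * (LINT x|lebesgue. norm (complex_of_real (P x) * f x))"
proof -
  have "(LINT x|lebesgue. indicator (- sublevel P t) x * norm (f x))
      \<le> (LINT x|lebesgue. 1 / t * norm (complex_of_real (P x) * f x))"
  proof (rule integral_mono)
    show "integrable lebesgue (\<lambda>x. indicator (- sublevel P t) x * norm (f x))"
      using sublevel_measurable[OF P, of t] by (intro integrable_indicator_norm f) (simp only: Compl_in_sets_lebesgue)
    show "integrable lebesgue (\<lambda>x. 1 / t * norm (complex_of_real (P x) * f x))"
      by (intro integrable_mult_right integrable_norm f)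
    show "indicator (- sublevel P t) x * norm (f x) \<le> 1 / t * norm (complex_of_real (P x) * f x)" for x
    proof (cases "x \<in> sublevel P t")
      case False
      then have "t * norm (f x) \<le> \<bar>P x\<bar> * norm (f x)"
        by (intro mult_right_mono) (auto simp: sublevel_def)
      then show ?thesis using False t by (simp add: norm_mult field_simps)
    qed (use t in simp)
  qed
  then show ?thesis by (simp only: integral_mult_right_zero)
qed

lemma test_functions_eigenvalue:
  assumes "f \<in> test_functions r P"
  shows "\<exists>c\<in>{\<i> ^ r, - (\<i> ^ r)}. AE x in lebesgue. fourier f x = c * f x"
  using assms by (auto simp: test_functions_def)

lemma norm_eigenvalue: "c \<in> {\<i> ^ r, - (\<i> ^ r)} \<Longrightarrow> norm c = 1"
  by (auto simp: norm_power)

text \<open>The mass off the sub-level set is at most \<open>\<parallel>P f\<parallel>\<^sub>1 / t\<close>. The two eigenvalues come with two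
constants in the uncertainty inequality, and their sum covers both.\<close>

lemma exists_bounds_with_1:
  assumes P: "P \<in> borel_measurable lebesgue"
    and t: "t > 0" "emeasure lebesgue (sublevel P t) < \<infinity>"
  shows "\<exists>C>0. bounds_with r P 1 C"
proof -
  note A = sublevel_measurable[OF P, of t]
  have "\<forall>c\<in>{\<i> ^ r, - (\<i> ^ r)}. \<exists>C. C > 0 \<and> (\<forall>f. integrable lebesgue f \<longrightarrow> (AE x in lebesgue. fourier f x = c * f x) \<longrightarrow>
      (LINT x|lebesgue. norm (f x)) \<le> C * (LINT x|lebesgue. indicator (- sublevel P t) x * norm (f x)))"
    using eigenfunction_annihilating[OF A t(2) norm_eigenvalue] by (intro ballI)
  from bchoice[OF this] obtain C where C': "\<forall>c\<in>{\<i> ^ r, - (\<i> ^ r)}. C c > 0 \<and> (\<forall>f. integrable lebesgue f \<longrightarrow> (AE x in lebesgue. fourier f x = c * f x) \<longrightarrow>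
      (LINT x|lebesgue. norm (f x)) \<le> C c * (LINT x|lebesgue. indicator (- sublevel P t) x * norm (f x)))" ..
  have C: "C c > 0"
    "\<And>f. integrable lebesgue f \<Longrightarrow> (AE x in lebesgue. fourier f x = c * f x) \<Longrightarrow>
      (LINT x|lebesgue. norm (f x)) \<le> C c * (LINT x|lebesgue. indicator (- sublevel P t) x * norm (f x))"
    if "c \<in> {\<i> ^ r, - (\<i> ^ r)}" for c
    using conjunct1[OF bspec[OF C' that]] conjunct2[OF bspec[OF C' that], rule_format] by this
  define K where "K = C (\<i> ^ r) + C (- (\<i> ^ r))"
  have CK: "C c \<le> K" if "c \<in> {\<i> ^ r, - (\<i> ^ r)}" for c
    using that C(1)[of "\<i> ^ r"] C(1)[of "- (\<i> ^ r)"] by (auto simp: K_def)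
  have K: "K > 0" using C(1)[of "\<i> ^ r"] C(1)[of "- (\<i> ^ r)"] by (simp add: K_def)
  have "bounds_with r P 1 (K / t)"
  proof (rule bounds_with_1I)
    fix f assume f: "f \<in> test_functions r P"
    then have i: "integrable lebesgue f" "integrable lebesgue (\<lambda>x. complex_of_real (P x) * f x)"
      by (auto simp: test_functions_def)
    obtain c where c: "c \<in> {\<i> ^ r, - (\<i> ^ r)}" "AE x in lebesgue. fourier f x = c * f x"
      using test_functions_eigenvalue[OF f] by blast
    have "(LINT x|lebesgue. norm (f x)) \<le> C c * (LINT x|lebesgue. indicator (- sublevel P t) x * norm (f x))"
      by (rule C(2)[OF c(1) i(1) c(2)])
    also have "\<dots> \<le> K * (LINT x|lebesgue. indicator (- sublevel P t) x * norm (f x))"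
      by (intro mult_right_mono CK c integral_nonneg_AE) auto
    also have "\<dots> \<le> K * (1 / t * (LINT x|lebesgue. norm (complex_of_real (P x) * f x)))"
      using K by (intro mult_left_mono integral_off_sublevel_le P t i) auto
    finally show "(LINT x|lebesgue. norm (f x)) \<le> K / t * (LINT x|lebesgue. norm (complex_of_real (P x) * f x))"
      by simp
  qed (use K t in auto)
  then show ?thesis using K t by (intro exI[of _ "K / t"]) auto
qed

text \<open>An eigenfunction is bounded by its own \<open>L\<^sup>1\<close> norm, so the same constant serves.\<close>

lemma bounds_with_infinity:
  assumes "bounds_with r P 1 C"
  shows "bounds_with r P \<infinity> C"
  unfolding bounds_with_def
proof
  fix f assume f: "f \<in> test_functions r P"
  then have i: "integrable lebesgue f" by (auto simp: test_functions_def)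
  obtain c where c: "c \<in> {\<i> ^ r, - (\<i> ^ r)}" "AE x in lebesgue. fourier f x = c * f x"
    using test_functions_eigenvalue[OF f] by blast
  have "Lq_norm lebesgue \<infinity> f \<le> ennreal (LINT x|lebesgue. norm (f x))"
    unfolding Lq_norm_def if_P[OF refl]
  proof (rule esssup_I)
    show "(\<lambda>x. ennreal (norm (f x))) \<in> borel_measurable lebesgue" using i by measurable
    show "AE x in lebesgue. ennreal (norm (f x)) \<le> ennreal (LINT x|lebesgue. norm (f x))"
      using AE_norm_eigenfunction_le[OF c(2) norm_eigenvalue[OF c(1)]]
      by eventually_elim (rule ennreal_leI)
  qed
  also have "\<dots> = Lq_norm lebesgue 1 f"
    unfolding Lq_norm_1 using nn_integral_eq_integral[OF integrable_norm[OF i]] by simp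
  also have "\<dots> \<le> ennreal C * Lq_norm lebesgue 1 (\<lambda>x. complex_of_real (P x) * f x)"
    using assms f by (auto simp: bounds_with_def)
  finally show "Lq_norm lebesgue \<infinity> f \<le> ennreal C * Lq_norm lebesgue 1 (\<lambda>x. complex_of_real (P x) * f x)" .
qed

section \<open>Explicit constants for homogeneous weights\<close>

text \<open>With \<open>M = |A\<^sub>t|\<close> the bound \<open>|f| \<le> \<parallel>f\<parallel>\<^sub>1\<close> gives
\<open>\<parallel>f\<parallel>\<^sub>1 \<le> M \<parallel>f\<parallel>\<^sub>1 + \<parallel>P f\<parallel>\<^sub>1 / t\<close>; for \<open>M < 1\<close> the first term is absorbed.\<close>

lemma bounds_with_small_sublevel:
  assumes P: "P \<in> borel_measurable lebesgue" and t: "t > 0"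
    and A: "emeasure lebesgue (sublevel P t) < \<infinity>" "measure lebesgue (sublevel P t) < 1"
  shows "bounds_with r P 1 (1 / (t * (1 - measure lebesgue (sublevel P t))))"
proof (rule bounds_with_1I)
  define M where "M = measure lebesgue (sublevel P t)"
  show "0 \<le> 1 / (t * (1 - measure lebesgue (sublevel P t)))" using t A by simp
  note Am = sublevel_measurable[OF P, of t]
  fix f assume f: "f \<in> test_functions r P"
  then have i: "integrable lebesgue f" "integrable lebesgue (\<lambda>x. complex_of_real (P x) * f x)"
    by (auto simp: test_functions_def)
  obtain c where c: "c \<in> {\<i> ^ r, - (\<i> ^ r)}" "AE x in lebesgue. fourier f x = c * f x"
    using test_functions_eigenvalue[OF f] by blast
  define L where "L = (LINT x|lebesgue. norm (f x))"
  define Q where "Q = (LINT x|lebesgue. norm (complex_of_real (P x) * f x))"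
  have b: "AE x in lebesgue. norm (f x) \<le> L"
    using AE_norm_eigenfunction_le[OF c(2) norm_eigenvalue[OF c(1)]] by (simp add: L_def)
  have "L = (LINT x|lebesgue. indicator (sublevel P t) x * norm (f x) + indicator (- sublevel P t) x * norm (f x))"
    unfolding L_def by (intro Bochner_Integration.integral_cong) (auto simp: indicator_def)
  also have "\<dots> = (LINT x|lebesgue. indicator (sublevel P t) x * norm (f x))
      + (LINT x|lebesgue. indicator (- sublevel P t) x * norm (f x))"
    using Am by (intro Bochner_Integration.integral_add integrable_indicator_norm i) (simp_all only: Compl_in_sets_lebesgue)
  also have "(LINT x|lebesgue. indicator (sublevel P t) x * norm (f x)) \<le> (LINT x|lebesgue. L * indicator (sublevel P t) x)"
  proof (rule integral_mono_AE)
    show "integrable lebesgue (\<lambda>x. indicator (sublevel P t) x * norm (f x))"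
      by (intro integrable_indicator_norm i Am)
    show "integrable lebesgue (\<lambda>x. L * indicator (sublevel P t) x)"
      using A Am by (intro integrable_mult_right integrable_real_indicator)
    show "AE x in lebesgue. indicator (sublevel P t) x * norm (f x) \<le> L * indicator (sublevel P t) x"
      using b by eventually_elim (auto simp: indicator_def)
  qed
  also have "(LINT x|lebesgue. L * indicator (sublevel P t) x) = L * M"
    by (simp add: M_def)
  also have "(LINT x|lebesgue. indicator (- sublevel P t) x * norm (f x)) \<le> 1 / t * Q"
    unfolding Q_def by (rule integral_off_sublevel_le[OF P t i])
  finally have "L \<le> L * M + 1 / t * Q" by simp
  then have "L * (t * (1 - M)) \<le> Q" using t by (simp add: field_simps)
  moreover have "t * (1 - M) > 0" using t A by (simp add: M_def)
  ultimately have "L \<le> 1 / (t * (1 - M)) * Q" by (simp add: pos_le_divide_eq)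
  then show "(LINT x|lebesgue. norm (f x)) \<le> 1 / (t * (1 - measure lebesgue (sublevel P t)))
      * (LINT x|lebesgue. norm (complex_of_real (P x) * f x))"
    by (simp only: L_def Q_def M_def)
qed

lemma best_constant_le:
  assumes "C > 0" "bounds_with r P q C"
  shows "best_constant r P q \<le> ennreal C"
  unfolding best_constant_def using assms by (intro Inf_lower) auto

text \<open>By homogeneity the sub-level set on the left is the dilate by \<open>\<delta>\<close> of the one on the right.\<close>

lemma emeasure_sublevel_homogeneous:
  fixes P :: "'a::euclidean_space \<Rightarrow> real"
  assumes h: "homogeneous \<gamma> P" and d: "\<delta> > 0"
  shows "emeasure lebesgue (sublevel P (\<delta> powr \<gamma> * t)) = ennreal (\<delta> ^ DIM('a)) * emeasure lebesgue (sublevel P t)"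
proof -
  have *: "\<bar>P (\<delta> *\<^sub>R x)\<bar> \<le> \<delta> powr \<gamma> * t \<longleftrightarrow> \<bar>P x\<bar> \<le> t" for x
    using h d by (simp add: homogeneous_def abs_mult)
  have "sublevel P (\<delta> powr \<gamma> * t) = (\<lambda>x. \<delta> *\<^sub>R x + 0) ` sublevel P t"
  proof (intro equalityI subsetI)
    fix y assume "y \<in> sublevel P (\<delta> powr \<gamma> * t)"
    then have "inverse \<delta> *\<^sub>R y \<in> sublevel P t"
      using *[of "inverse \<delta> *\<^sub>R y"] d by (simp add: sublevel_def)
    then show "y \<in> (\<lambda>x. \<delta> *\<^sub>R x + 0) ` sublevel P t"
      using d by (intro image_eqI[of _ _ "inverse \<delta> *\<^sub>R y"]) auto
  qed (use * in \<open>auto simp: sublevel_def\<close>)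
  then show ?thesis
    using d by (simp only: emeasure_lebesgue_affine) (simp add: ennreal_power)
qed

text \<open>Sub-level sets are invariant under dilation by 2, which multiplies measure by \<open>2 ^ d\<close>; one of
finite measure is therefore null. Hence \<open>|P|\<close> has a positive essential infimum, and multiplying
by \<open>P\<close> enlarges \<open>|f|\<close> at least by this factor.\<close>

lemma best_constant_homogeneous_0:
  fixes P :: "'a::euclidean_space \<Rightarrow> real"
  assumes P: "P \<in> borel_measurable lebesgue" and h: "homogeneous 0 P"
    and t: "t > 0" "emeasure lebesgue (sublevel P t) < \<infinity>"
  defines "m \<equiv> ess_inf lebesgue (\<lambda>x. ennreal \<bar>P x\<bar>)"
  shows "best_constant r P 1 \<le> inverse m" and "inverse m < \<infinity>"
proof -
  define Z where "Z = {z. AE x in lebesgue. z \<le> ennreal \<bar>P x\<bar>}"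
  have m: "m = Sup Z" by (simp add: m_def ess_inf_def Z_def)
  have "emeasure lebesgue (sublevel P t) = ennreal (2 ^ DIM('a)) * emeasure lebesgue (sublevel P t)"
    using emeasure_sublevel_homogeneous[OF h, of 2 t] by simp
  moreover obtain a where a: "a \<ge> 0" "emeasure lebesgue (sublevel P t) = ennreal a"
    using t(2) by (cases "emeasure lebesgue (sublevel P t)") auto
  ultimately have "ennreal a = ennreal (2 ^ DIM('a) * a)"
    by (simp add: ennreal_mult)
  then have "a = 2 ^ DIM('a) * a" using a(1) by (subst (asm) ennreal_inj) auto
  moreover have "(2::real) ^ DIM('a) > 1" by (intro one_less_power) auto
  ultimately have "a = 0" by auto
  then have null: "sublevel P t \<in> null_sets lebesgue"
    using a sublevel_measurable[OF P] by (auto simp: null_sets_def)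
  have tZ: "ennreal t \<in> Z"
    unfolding Z_def using AE_not_in[OF null]
    by (auto elim!: eventually_mono intro!: ennreal_leI simp: sublevel_def)
  then have tm: "ennreal t \<le> m" unfolding m by (rule Sup_upper)
  then have mpos: "m > 0" using t(1) by (auto intro: less_le_trans[of 0 "ennreal t"])
  then show "inverse m < \<infinity>" by (cases m) (auto simp: inverse_ennreal)
  \<comment> \<open>The supremum is that of a sequence, so the exceptional null sets can be united.\<close>
  have AEm: "AE x in lebesgue. m \<le> ennreal \<bar>P x\<bar>"
  proof -
    have "Z \<noteq> {}" using tZ by auto
    from ennreal_Sup_countable_SUP[OF this]
    obtain g :: "nat \<Rightarrow> ennreal" where g: "range g \<subseteq> Z" "Sup Z = (SUP i. g i)" by blast
    have "AE x in lebesgue. \<forall>i. g i \<le> ennreal \<bar>P x\<bar>"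
      unfolding AE_all_countable using g(1) by (auto simp: Z_def)
    then show ?thesis unfolding m g(2) by eventually_elim (auto intro: SUP_least)
  qed
  have "\<exists>x. m \<le> ennreal \<bar>P x\<bar>"
  proof (rule ccontr)
    assume "\<not> ?thesis"
    then have "AE x in (lebesgue :: 'a measure). False" using AEm by auto
    then show False by (simp add: eventually_False ae_filter_eq_bot_iff)
  qed
  then obtain x where "m \<le> ennreal \<bar>P x\<bar>" by blast
  then have "m < \<infinity>" by (auto intro: le_less_trans)
  then obtain \<mu> where \<mu>: "\<mu> \<ge> 0" "m = ennreal \<mu>" by (cases m) auto
  have \<mu>0: "\<mu> > 0" using mpos \<mu> by (cases "\<mu> = 0") auto
  have AE\<mu>: "AE x in lebesgue. \<mu> \<le> \<bar>P x\<bar>" using AEm unfolding \<mu>(2) by (simp add: ennreal_le_iff)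
  have "bounds_with r P 1 (1 / \<mu>)"
  proof (rule bounds_with_1I)
    fix f assume "f \<in> test_functions r P"
    then have i: "integrable lebesgue f" "integrable lebesgue (\<lambda>x. complex_of_real (P x) * f x)"
      by (auto simp: test_functions_def)
    have "(LINT x|lebesgue. norm (f x)) \<le> (LINT x|lebesgue. 1 / \<mu> * norm (complex_of_real (P x) * f x))"
    proof (rule integral_mono_AE)
      show "AE x in lebesgue. norm (f x) \<le> 1 / \<mu> * norm (complex_of_real (P x) * f x)"
        using AE\<mu>
      proof eventually_elim
        case (elim x)
        then have "\<mu> * norm (f x) \<le> \<bar>P x\<bar> * norm (f x)" by (intro mult_right_mono) auto
        then show ?case using \<mu>0 by (simp add: norm_mult field_simps)
      qed
    qed (intro integrable_mult_right integrable_norm i)+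
    then show "(LINT x|lebesgue. norm (f x)) \<le> 1 / \<mu> * (LINT x|lebesgue. norm (complex_of_real (P x) * f x))"
      by (simp only: integral_mult_right_zero)
  qed (use \<mu>0 in simp)
  then have "best_constant r P 1 \<le> ennreal (1 / \<mu>)"
    using \<mu>0 by (intro best_constant_le) auto
  then show "best_constant r P 1 \<le> inverse m"
    using \<mu>0 \<mu>(2) by (simp add: inverse_ennreal inverse_eq_divide)
qed

text \<open>With \<open>a = d / \<gamma>\<close> and \<open>M = |A\<^sub>1|\<close> the constant for the level \<open>s\<close> is
\<open>1 / (s (1 - s powr a * M))\<close>. It is smallest when \<open>(1 + a) * s powr a * M = 1\<close>, that is, when
\<open>|A\<^sub>s| = 1 / (1 + a)\<close>.\<close>

lemma best_constant_homogeneous_pos: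
  fixes P :: "'a::euclidean_space \<Rightarrow> real"
  assumes P: "P \<in> borel_measurable lebesgue" and h: "homogeneous \<gamma> P" and \<gamma>: "\<gamma> > 0"
    and t: "t > 0" "emeasure lebesgue (sublevel P t) < \<infinity>"
  shows "emeasure lebesgue (sublevel P 1) < \<infinity>"
    and "best_constant r P 1 \<le> ennreal ((1 + \<gamma> / DIM('a)) *
          ((1 + DIM('a) / \<gamma>) * measure lebesgue (sublevel P 1)) powr (\<gamma> / DIM('a)))"
proof -
  define a where "a = DIM('a) / \<gamma>"
  have a: "a > 0" using \<gamma> by (simp add: a_def)
  have scale: "emeasure lebesgue (sublevel P s) = ennreal (s powr a) * emeasure lebesgue (sublevel P 1)"
    if "s > 0" for s
  proof -
    have "(s powr (1 / \<gamma>)) powr \<gamma> * 1 = s" using that \<gamma> by (simp add: powr_powr)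
    moreover have "(s powr (1 / \<gamma>)) ^ DIM('a) = s powr a"
      using that by (simp add: powr_realpow[symmetric] powr_powr a_def)
    ultimately show ?thesis
      using emeasure_sublevel_homogeneous[OF h, of "s powr (1 / \<gamma>)" 1] that by simp
  qed
  have "ennreal (t powr a) \<noteq> 0" using t by simp
  then show fin: "emeasure lebesgue (sublevel P 1) < \<infinity>"
    using scale[OF t(1)] t(2) by (auto simp: ennreal_mult_less_top)
  define M where "M = measure lebesgue (sublevel P 1)"
  have eM: "emeasure lebesgue (sublevel P 1) = ennreal M"
    using fin by (simp add: M_def emeasure_eq_ennreal_measure)
  have M0: "M \<ge> 0" by (simp add: M_def)
  have es: "emeasure lebesgue (sublevel P s) = ennreal (s powr a * M)" if "s > 0" for s
    using scale[OF that] eM M0 by (simp add: ennreal_mult)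
  \<comment> \<open>Otherwise every level set would be null, but together they cover the space.\<close>
  have "M \<noteq> 0"
  proof
    assume "M = 0"
    then have "sublevel P (real (Suc n)) \<in> null_sets lebesgue" for n
      using es[of "real (Suc n)"] sublevel_measurable[OF P] by (auto simp: null_sets_def)
    then have "(\<Union>n. sublevel P (real (Suc n))) \<in> null_sets lebesgue"
      by (intro null_sets_UN') auto
    moreover have "(\<Union>n. sublevel P (real (Suc n))) = UNIV"
    proof -
      have "\<exists>n. \<bar>P x\<bar> \<le> real (Suc n)" for x
      proof -
        obtain n where "\<bar>P x\<bar> \<le> real n" using real_arch_simple by blast
        then have "\<bar>P x\<bar> \<le> real (Suc n)" by simp
        then show ?thesis ..
      qed
      then show ?thesis by (auto simp: sublevel_def)
    qed
    ultimately show False by (auto simp: null_sets_def)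
  qed
  then have M: "M > 0" using M0 by simp
  define s where "s = ((1 + a) * M) powr (- (1 / a))"
  have s: "s > 0" using M a by (simp add: s_def)
  have "s powr a = 1 / ((1 + a) * M)"
    unfolding s_def powr_powr using M a by (simp add: powr_neg_one)
  then have "s powr a * M = 1 / (1 + a)" using M by simp
  then have e: "emeasure lebesgue (sublevel P s) = ennreal (1 / (1 + a))" using es[OF s] by simp
  then have m: "measure lebesgue (sublevel P s) = 1 / (1 + a)" using a by (simp add: measure_def)
  have "bounds_with r P 1 (1 / (s * (1 - 1 / (1 + a))))"
    using bounds_with_small_sublevel[OF P s, of r] e m a by simp
  moreover have "1 / (s * (1 - 1 / (1 + a))) = (1 + 1 / a) * ((1 + a) * M) powr (1 / a)"
  proof -
    have "1 - 1 / (1 + a) = a / (1 + a)" using a by (simp add: field_simps)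
    moreover have "1 / s = ((1 + a) * M) powr (1 / a)" by (simp add: s_def powr_minus_divide)
    moreover have "1 / (s * (a / (1 + a))) = 1 / s * ((1 + a) / a)" by simp
    moreover have "(1 + a) / a = 1 + 1 / a" using a by (simp add: field_simps)
    ultimately show ?thesis by (simp only: mult.commute)
  qed
  moreover have "(1 + 1 / a) * ((1 + a) * M) powr (1 / a) > 0"
    using a M by (intro mult_pos_pos) (auto intro!: add_pos_pos)
  ultimately have "best_constant r P 1 \<le> ennreal ((1 + 1 / a) * ((1 + a) * M) powr (1 / a))"
    by (intro best_constant_le) auto
  then show "best_constant r P 1 \<le> ennreal ((1 + \<gamma> / DIM('a)) *
          ((1 + DIM('a) / \<gamma>) * measure lebesgue (sublevel P 1)) powr (\<gamma> / DIM('a)))"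
    by (simp add: a_def M_def)
qed

theorem theorem2:
  fixes P :: "'a::euclidean_space \<Rightarrow> real" and r :: nat
  assumes "P \<in> borel_measurable lebesgue"
    and "\<exists>x. x \<noteq> 0 \<and> P x \<noteq> 0"
    and "locally_Lq 1 P"
    and "has_parity r P"
    and "\<exists>t>0. emeasure lebesgue (sublevel P t) < \<infinity>"
  shows "(\<exists>C>0. bounds_with r P 1 C) \<and>
    admissible r P \<infinity> \<and>
    (\<forall>\<gamma>\<ge>0. homogeneous \<gamma> P \<longrightarrow>
      (\<gamma> = 0 \<longrightarrow>
        best_constant r P 1 \<le> inverse (ess_inf lebesgue (\<lambda>x. ennreal \<bar>P x\<bar>)) \<and>
        inverse (ess_inf lebesgue (\<lambda>x. ennreal \<bar>P x\<bar>)) < \<infinity>) \<and>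
      (\<gamma> > 0 \<longrightarrow>
        emeasure lebesgue (sublevel P 1) < \<infinity> \<and>
        best_constant r P 1 \<le> ennreal ((1 + \<gamma> / DIM('a)) *
          ((1 + DIM('a) / \<gamma>) * measure lebesgue (sublevel P 1)) powr (\<gamma> / DIM('a)))))"
proof -
  obtain t where t: "t > 0" "emeasure lebesgue (sublevel P t) < \<infinity>" using assms(5) by blast
  obtain C where C: "C > 0" "bounds_with r P 1 C"
    using exists_bounds_with_1[OF assms(1) t] by blast
  have "admissible r P \<infinity>"
    unfolding admissible_def
  proof (intro conjI)
    show "\<exists>C>0. bounds_with r P \<infinity> C" using C bounds_with_infinity by blast
    have "1 / (\<infinity>::ennreal) + 1 / 1 = 1" by simp
    then show "if 1 < (\<infinity>::ennreal) then \<exists>q'. 1 / \<infinity> + 1 / q' = 1 \<and> locally_Lq q' P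
      else ((\<lambda>\<rho>. Lq_norm (lebesgue_on (ball 0 \<rho>)) \<infinity> P) \<longlongrightarrow> 0) (at_right 0)"
      using assms(3) by (auto intro!: exI[of _ 1])
  qed (use assms in auto)
  then show ?thesis
  proof (intro conjI allI impI)
    show "\<exists>C>0. bounds_with r P 1 C" using C by blast
    fix \<gamma> :: real assume h: "homogeneous \<gamma> P"
    show "best_constant r P 1 \<le> inverse (ess_inf lebesgue (\<lambda>x. ennreal \<bar>P x\<bar>))"
      and "inverse (ess_inf lebesgue (\<lambda>x. ennreal \<bar>P x\<bar>)) < \<infinity>" if "\<gamma> = 0"
      using best_constant_homogeneous_0[OF assms(1) _ t] h that by blast+
    show "emeasure lebesgue (sublevel P 1) < \<infinity>"
      and "best_constant r P 1 \<le> ennreal ((1 + \<gamma> / DIM('a)) *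
          ((1 + DIM('a) / \<gamma>) * measure lebesgue (sublevel P 1)) powr (\<gamma> / DIM('a)))" if "\<gamma> > 0"
      by (rule best_constant_homogeneous_pos[OF assms(1) h that t])+
  qed
qed

end
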